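(* Let $k\ge 2$, let $\mathcal{E}=[-1,1]$, let $f(x)=(1,x,\ldots,x^{k-1})^\top$, and let $v\in BV[-1,1]$ be a weight function, i.e. $v:[-1,1]\to[0,\infty)$ with $\int_{[-1,1]} v\,d\tilde\lambda=1$. Put $\nu_i=1/2$ if $i\in\{0,k-1\}$ and $\nu_i=1$ if $i\in\{1,\ldots,k-2\}$. For $i=0,\ldots,k-1$ let $$q_i=\frac{\nu_i}{2(k-1)}\sum_{j=0}^{2k-3}\cos\left(\frac{j(k-1-i)\pi}{k-1}\right)\int_{-1}^{1}T_j(x)v(x)\,dx,$$ where $T_j$ is the Chebyshev polynomial of the first kind of degree $j$. Let $$\alpha_0^{(k)}:=\min\left\{\frac{\nu_i}{(k-1)q_i}\ \Big|\ i=0,\ldots,k-1 \text{ with } q_i>0\right\}.$$ Then for every $r\in[0,\alpha_0^{(k)}]$, with $p_i=\frac{\nu_i}{k-1}-rq_i$ for $i=0,\ldots,k-1$, the design $$\xi=r\,v\cdot\tilde\lambda+\sum_{i=0}^{k-1}p_i\,\delta_{\cos(\pi(k-1-i)/(k-1))}$$ is $\mathbf{e}_k$-optimal in $\Upsilon_v[r]$.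
   Context: $BV[-1,1]$ denotes the set of functions $[-1,1]\to\mathbb{R}$ of bounded variation that are continuous from the right on $[-1,1)$ and continuous from the left at $1$. $\lambda$ is Lebesgue measure and $\tilde\lambda=\frac12\lambda|_{[-1,1]}$ is the uniform distribution on $[-1,1]$. $\delta_t$ is the Dirac measure at $t$. For a nonnegative measurable $w$ and a measure $\eta$, $(w\cdot\eta)(A)=\int_A w\,d\eta$. For measures, $\mu_1\le\mu_2$ means $\mu_1(B)\le\mu_2(B)$ for all Borel sets $B$. $\Xi$ is the set of designs: probability measures on $[-1,1]$ that are the sum of a finitely supported discrete measure and a measure absolutely continuous with respect to Lebesgue measure whose density belongs to $BV[-1,1]$. For $r\in[0,1]$, $\Upsilon_v[r]:=\{\xi\in\Xi \mid r\,v\cdot\tilde\lambda\le\xi\}$. For a design $\xi$, $M(\xi)=\int_{[-1,1]} f f^\top\,d\xi\in\mathbb{R}^{k\times k}$. $\mathbf{e}_k=(0,\ldots,0,1)^\top\in\mathbb{R}^k$. A design $\xi\in\Upsilon_v[r]$ is $\mathbf{e}_k$-optimal in $\Upsilon_v[r]$ (optimal for $\mathbf{e}_k^\top\boldsymbol\theta$) if it minimizes $\mathbf{e}_k^\top M(\xi)^{-1}\mathbf{e}_k$ over all designs in $\Upsilon_v[r]$, where for singular $M(\xi)$ this quantity is read as $\mathbf{e}_k^\top M(\xi)^{-}\mathbf{e}_k$ with a generalized inverse $M(\xi)^{-}$ if $\mathbf{e}_k$ lies in the range of $M(\xi)$, and as $+\infty$ otherwise. *)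

theory Defs
  imports
    "HOL-Probability.Probability"
    "Jordan_Normal_Form.Gauss_Jordan_Elimination"
begin

(* Lebesgue measure on the Borel sets of [-1,1]; every measure below lives on this sigma-algebra. *)
definition leb_I :: "real measure" where
  "leb_I = restrict_space lborel {-1..1}"

definition unif_I :: "real measure" where
  "unif_I = scale_measure (1/2) leb_I"

definition bounded_variation_on :: "(real \<Rightarrow> real) \<Rightarrow> real set \<Rightarrow> bool" where
  "bounded_variation_on g S \<longleftrightarrow>
     (\<exists>C. \<forall>(n::nat) t. t ` {..n} \<subseteq> S \<and> mono_on {..n} t \<longrightarrow>
        (\<Sum>i<n. \<bar>g (t (Suc i)) - g (t i)\<bar>) \<le> C)"

(* Functions on [-1,1] are total functions whose values outside [-1,1] are irrelevant. *)
definition BV_I :: "(real \<Rightarrow> real) set" where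
  "BV_I = {g. bounded_variation_on g {-1..1} \<and>
              (\<forall>x\<in>{-1..<1}. continuous (at_right x) g) \<and> continuous (at_left 1) g}"

definition weight_fun :: "(real \<Rightarrow> real) \<Rightarrow> bool" where
  "weight_fun v \<longleftrightarrow> v \<in> BV_I \<and> (\<forall>x\<in>{-1..1}. 0 \<le> v x) \<and> (\<integral>x. v x \<partial>unif_I) = 1"

definition measure_plus :: "'a measure \<Rightarrow> 'a measure \<Rightarrow> 'a measure" where
  "measure_plus \<mu> \<nu> = measure_of (space \<mu>) (sets \<mu>) (\<lambda>A. emeasure \<mu> A + emeasure \<nu> A)"

(* M only supplies the space and the sigma-algebra. *)
definition measure_sum :: "'a measure \<Rightarrow> 'i set \<Rightarrow> ('i \<Rightarrow> 'a measure) \<Rightarrow> 'a measure" where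
  "measure_sum M I \<mu> = measure_of (space M) (sets M) (\<lambda>A. \<Sum>i\<in>I. emeasure (\<mu> i) A)"

lemma sets_measure_plus [simp]: "sets (measure_plus \<mu> \<nu>) = sets \<mu>"
  and space_measure_plus [simp]: "space (measure_plus \<mu> \<nu>) = space \<mu>"
  by (simp_all add: measure_plus_def)

lemma sets_measure_sum [simp]: "sets (measure_sum M I \<mu>) = sets M"
  and space_measure_sum [simp]: "space (measure_sum M I \<mu>) = space M"
  by (simp_all add: measure_sum_def)

lemma emeasure_measure_plus:
  assumes "sets \<nu> = sets \<mu>" "A \<in> sets \<mu>"
  shows "emeasure (measure_plus \<mu> \<nu>) A = emeasure \<mu> A + emeasure \<nu> A"
proof (rule emeasure_measure_of[OF measure_plus_def])
  show "countably_additive (sets (measure_plus \<mu> \<nu>)) (\<lambda>A. emeasure \<mu> A + emeasure \<nu> A)"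
  proof (rule countably_additiveI)
    fix F :: "nat \<Rightarrow> _"
    assume "range F \<subseteq> sets (measure_plus \<mu> \<nu>)" and d: "disjoint_family F"
    then have F: "range F \<subseteq> sets \<mu>" "range F \<subseteq> sets \<nu>" using assms by auto
    then show "(\<Sum>i. emeasure \<mu> (F i) + emeasure \<nu> (F i)) = emeasure \<mu> (\<Union> (range F)) + emeasure \<nu> (\<Union> (range F))"
      by (simp add: suminf_add[symmetric] suminf_emeasure[OF _ d])
  qed
qed (use assms in \<open>auto simp: positive_def dest: sets.sets_into_space\<close>)

lemma emeasure_measure_sum:
  assumes "\<And>i. i \<in> I \<Longrightarrow> sets (\<mu> i) = sets M" "A \<in> sets M"
  shows "emeasure (measure_sum M I \<mu>) A = (\<Sum>i\<in>I. emeasure (\<mu> i) A)"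
proof (rule emeasure_measure_of[OF measure_sum_def])
  show "countably_additive (sets (measure_sum M I \<mu>)) (\<lambda>A. \<Sum>i\<in>I. emeasure (\<mu> i) A)"
  proof (rule countably_additiveI)
    fix F :: "nat \<Rightarrow> _"
    assume F: "range F \<subseteq> sets (measure_sum M I \<mu>)" and d: "disjoint_family F"
    have "(\<Sum>n. \<Sum>i\<in>I. emeasure (\<mu> i) (F n)) = (\<Sum>i\<in>I. \<Sum>n. emeasure (\<mu> i) (F n))"
      by (rule suminf_sum) simp
    also have "\<dots> = (\<Sum>i\<in>I. emeasure (\<mu> i) (\<Union> (range F)))"
      using F assms(1) by (intro sum.cong refl suminf_emeasure d) auto
    finally show "(\<Sum>n. \<Sum>i\<in>I. emeasure (\<mu> i) (F n)) = (\<Sum>i\<in>I. emeasure (\<mu> i) (\<Union> (range F)))" .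
  qed
qed (use assms in \<open>auto simp: positive_def dest: sets.sets_into_space\<close>)

definition designs :: "real measure set" where
  "designs = {\<xi>. prob_space \<xi> \<and>
     (\<exists>S w g. finite S \<and> S \<subseteq> {-1..1} \<and> (\<forall>t\<in>S. 0 \<le> w t) \<and>
        g \<in> BV_I \<and> (\<forall>x\<in>{-1..1}. 0 \<le> g x) \<and>
        \<xi> = measure_plus
              (measure_sum leb_I S (\<lambda>t. scale_measure (ennreal (w t)) (return leb_I t)))
              (density leb_I (\<lambda>x. ennreal (g x))))}"

definition designs_above :: "(real \<Rightarrow> real) \<Rightarrow> real \<Rightarrow> real measure set" where
  "designs_above v r = {\<xi> \<in> designs. \<forall>B\<in>sets leb_I.
     emeasure (scale_measure (ennreal r) (density unif_I (\<lambda>x. ennreal (v x)))) B \<le> emeasure \<xi> B}"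

definition reg_fun :: "nat \<Rightarrow> real \<Rightarrow> real Matrix.vec" where
  "reg_fun k x = Matrix.vec k (\<lambda>i. x ^ i)"

definition info_mat :: "nat \<Rightarrow> real measure \<Rightarrow> real Matrix.mat" where
  "info_mat k \<xi> = Matrix.mat k k
     (\<lambda>(i, j). \<integral>x. vec_index (reg_fun k x) i * vec_index (reg_fun k x) j \<partial>\<xi>)"

definition gen_inverse :: "real Matrix.mat \<Rightarrow> real Matrix.mat \<Rightarrow> bool" where
  "gen_inverse A G \<longleftrightarrow> G \<in> carrier_mat (dim_col A) (dim_row A) \<and> A * G * A = A"

(* The quantity c^T M^{-1} c. In the singular case the value does not depend on the chosen
   generalized inverse, since M is symmetric and c lies in its range. *)
definition c_criterion :: "nat \<Rightarrow> real Matrix.vec \<Rightarrow> real measure \<Rightarrow> ereal" where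
  "c_criterion k c \<xi> = (let M = info_mat k \<xi> in
     case mat_inverse M of
       Some N \<Rightarrow> ereal (scalar_prod c (N *\<^sub>v c))
     | None \<Rightarrow>
         if \<exists>z\<in>carrier_vec k. M *\<^sub>v z = c
         then ereal (scalar_prod c ((SOME G. gen_inverse M G) *\<^sub>v c))
         else \<infinity>)"

definition c_optimal :: "nat \<Rightarrow> real Matrix.vec \<Rightarrow> real measure set \<Rightarrow> real measure \<Rightarrow> bool" where
  "c_optimal k c D \<xi> \<longleftrightarrow> \<xi> \<in> D \<and> (\<forall>\<eta>\<in>D. c_criterion k c \<xi> \<le> c_criterion k c \<eta>)"

(* Coordinates are numbered from 0. *)
abbreviation e_last :: "nat \<Rightarrow> real Matrix.vec" where
  "e_last k \<equiv> unit_vec k (k - 1)"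

fun cheb_T :: "nat \<Rightarrow> real \<Rightarrow> real" where
  "cheb_T 0 x = 1"
| "cheb_T (Suc 0) x = x"
| "cheb_T (Suc (Suc n)) x = 2 * x * cheb_T (Suc n) x - cheb_T n x"

definition nu :: "nat \<Rightarrow> nat \<Rightarrow> real" where
  "nu k i = (if i = 0 \<or> i = k - 1 then 1/2 else 1)"

definition node :: "nat \<Rightarrow> nat \<Rightarrow> real" where
  "node k i = cos (pi * (real k - 1 - real i) / (real k - 1))"

definition q_weight :: "nat \<Rightarrow> (real \<Rightarrow> real) \<Rightarrow> nat \<Rightarrow> real" where
  "q_weight k v i = nu k i / (2 * (real k - 1)) *
     (\<Sum>j = 0..2 * k - 3. cos (real j * (real k - 1 - real i) * pi / (real k - 1)) *
        (LBINT x:{-1..1}. cheb_T j x * v x))"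

definition alpha0 :: "nat \<Rightarrow> (real \<Rightarrow> real) \<Rightarrow> real" where
  "alpha0 k v = Min {nu k i / ((real k - 1) * q_weight k v i) | i. i < k \<and> q_weight k v i > 0}"

definition p_weight :: "nat \<Rightarrow> (real \<Rightarrow> real) \<Rightarrow> real \<Rightarrow> nat \<Rightarrow> real" where
  "p_weight k v r i = nu k i / (real k - 1) - r * q_weight k v i"

(* ennreal truncates negative reals to 0, so this is the intended measure only if
   all p_weight k v r i are nonnegative. *)
definition opt_design :: "nat \<Rightarrow> (real \<Rightarrow> real) \<Rightarrow> real \<Rightarrow> real measure" where
  "opt_design k v r = measure_plus
     (scale_measure (ennreal r) (density unif_I (\<lambda>x. ennreal (v x))))
     (measure_sum leb_I {..<k}
        (\<lambda>i. scale_measure (ennreal (p_weight k v r i)) (return leb_I (node k i))))"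

end

(*
  With n = k - 1, the nodes are the points where the Chebyshev polynomial T_n takes the values
  +1 and -1, and the weights nu_i / n make T_n orthogonal to all polynomials of lower degree.
  The q_i are the weights of a quadrature rule for v on the nodes that is exact on 1 and on T_n g
  for deg g < n, by the aliasing T_s = T_{2n-s} on the nodes. Hence shifting the mass r from the
  nodes to r v keeps the orthogonality: if t is the coefficient vector of T_n, then M(xi) t is a
  multiple of e_k and e_k^T M(xi)^- e_k = t_k^2 / rho with rho the integral of T_n^2 under xi.
  Conversely the Cauchy-Schwarz inequality gives the lower bound t_k^2 / (integral of T_n^2 under eta)
  for every design eta, and if eta dominates r v then this integral is at most rho, because
  1 - T_n^2 is nonnegative and vanishes on the nodes.
*)
theory Submission
  imports Defs
begin

section \<open>Generalized inverses\<close>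

(* A * G is the orthogonal projection onto the span of the first m columns; adding the next
   column is one Gram-Schmidt step, a rank-one update of G. *)
lemma partial_gen_inverse:
  fixes A :: "real mat"
  assumes A: "A \<in> carrier_mat n n" and "m \<le> n"
  shows "\<exists>G\<in>carrier_mat n n. (\<forall>i<m. (A * G) *\<^sub>v col A i = col A i) \<and>
    transpose_mat (A * G) = A * G \<and> (A * G) * (A * G) = A * G"
  using \<open>m \<le> n\<close>
proof (induction m)
  case 0
  show ?case
    by (rule bexI[of _ "0\<^sub>m n n"]) (use A in auto)
next
  case (Suc m)
  then obtain G where G: "G \<in> carrier_mat n n"
    and fix': "\<And>i. i < m \<Longrightarrow> (A * G) *\<^sub>v col A i = col A i"
    and sym: "transpose_mat (A * G) = A * G" and idem: "(A * G) * (A * G) = A * G"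
    by auto
  define P where "P = A * G"
  have P: "P \<in> carrier_mat n n" using A G by (simp add: P_def)
  define a where "a = col A m"
  have a: "a \<in> carrier_vec n" using A by (simp add: a_def carrier_vecI)
  \<comment> \<open>The part of the new column orthogonal to the columns treated so far. If it
    vanishes, \<open>P\<close> already fixes the new column and \<open>G\<close> is kept.\<close>
  define u where "u = a - P *\<^sub>v a"
  have u: "u \<in> carrier_vec n" using P a by (simp add: u_def)
  have PPa: "P *\<^sub>v (P *\<^sub>v a) = P *\<^sub>v a"
    using idem a P by (metis P_def assoc_mult_mat_vec)
  have Pu: "P *\<^sub>v u = 0\<^sub>v n"
    unfolding u_def using P a PPa by (subst mult_minus_distrib_mat_vec) auto
  have adj: "scalar_prod (P *\<^sub>v x) y = scalar_prod x (P *\<^sub>v y)"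
    if "x \<in> carrier_vec n" "y \<in> carrier_vec n" for x y
    using transpose_vec_mult_scalar[OF P that(2) that(1)] sym that P
    by (simp add: P_def[symmetric] comm_scalar_prod[of _ n])
  show ?case
  proof (cases "u = 0\<^sub>v n")
    case True
    have "P *\<^sub>v a = a"
    proof (rule eq_vecI)
      fix i assume "i < dim_vec a"
      then have i: "i < n" using a by auto
      have "u $ i = 0" using True i by simp
      then show "(P *\<^sub>v a) $ i = a $ i" using i a P by (simp add: u_def)
    qed (use P a in auto)
    then show ?thesis
      using G fix' sym idem by (intro bexI[of _ G]) (auto simp: less_Suc_eq a_def P_def)
  next
    case False
    define c where "c = scalar_prod u u"
    have c: "c \<noteq> 0" 
    proof
      assume "c = 0"
      then have "u $ i = 0" if "i < n" for i
        using that u by (auto simp: c_def scalar_prod_def sum_nonneg_eq_0_iff)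
      then show False using False u by (auto intro: eq_vecI)
    qed
    \<comment> \<open>A preimage of \<open>u\<close> under \<open>A\<close>: the unit vector is
      mapped to \<open>a\<close>, and \<open>G *\<^sub>v a\<close> to \<open>P *\<^sub>v a\<close>.
      Such a preimage is needed because the projection must keep the form
      \<open>A * G\<close>.\<close>
    define w where "w = unit_vec n m - G *\<^sub>v a"
    have w: "w \<in> carrier_vec n" using G a by (simp add: w_def)
    have "A *\<^sub>v unit_vec n m = a"
      using A Suc.prems by (intro eq_vecI) (auto simp: a_def)
    then have Aw: "A *\<^sub>v w = u"
      unfolding w_def u_def P_def using A G a
      by (subst mult_minus_distrib_mat_vec) (auto simp: assoc_mult_mat_vec)
    \<comment> \<open>\<open>W\<close> is the rank-one matrix w u^T / c, so \<open>A * W\<close>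
      becomes \<open>U\<close> = u u^T / c, the orthogonal projection onto the line spanned by
      \<open>u\<close>.\<close>
    define W where "W = mat n n (\<lambda>(i,j). w $ i * u $ j / c)"
    define U where "U = mat n n (\<lambda>(i,j). u $ i * u $ j / c)"
    have W: "W \<in> carrier_mat n n" and U: "U \<in> carrier_mat n n" by (simp_all add: W_def U_def)
    have AW: "A * W = U"
    proof (rule eq_matI)
      fix i j assume ij: "i < dim_row U" "j < dim_col U"
      then have "(A * W) $$ (i,j) = (A *\<^sub>v w) $ i * u $ j / c"
        using A w by (auto simp: W_def U_def scalar_prod_def sum_distrib_right sum_divide_distrib mult.assoc
            intro!: sum.cong)
      then show "(A * W) $$ (i,j) = U $$ (i,j)" using ij by (simp add: Aw U_def)
    qed (use A W U in auto)
    have Uv: "U *\<^sub>v x = (scalar_prod u x / c) \<cdot>\<^sub>v u" if "x \<in> carrier_vec n" for x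
      using that u by (auto simp: U_def scalar_prod_def sum_distrib_right sum_distrib_left sum_divide_distrib
          intro!: eq_vecI sum.cong)
    have AG: "A * (G + W) = P + U"
      using A G W AW by (simp add: mult_add_distrib_mat P_def)
    have ua: "scalar_prod u a = c"
    proof -
      have "scalar_prod u (P *\<^sub>v a) = 0" using adj[OF u a] Pu a by simp
      then show ?thesis
        using u a P unfolding c_def
        by (simp add: u_def scalar_prod_minus_distrib[of _ n])
    qed
    have fx: "(P + U) *\<^sub>v col A i = col A i" if "i < Suc m" for i
    proof -
      have ci: "col A i \<in> carrier_vec n" using A by (simp add: carrier_vecI)
      have dist: "(P + U) *\<^sub>v col A i = P *\<^sub>v col A i + U *\<^sub>v col A i"
        using P U ci by (simp add: add_mult_distrib_mat_vec)
      show ?thesis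
      proof (cases "i = m")
        case True
        have "U *\<^sub>v a = u" using Uv[OF a] ua c u by simp
        then show ?thesis using dist True a P by (auto simp: a_def[symmetric] u_def)
      next
        case False
        then have Pi: "P *\<^sub>v col A i = col A i" using fix'[of i] that by (simp add: P_def)
        have "scalar_prod u (col A i) = 0" using adj[OF u ci] Pu Pi ci by simp
        then have "U *\<^sub>v col A i = 0\<^sub>v n" using Uv[OF ci] u by auto
        then show ?thesis using dist Pi ci by simp
      qed
    qed
    have Usym: "transpose_mat U = U" by (rule eq_matI) (auto simp: U_def)
    have tsym: "transpose_mat (P + U) = P + U"
      using transpose_add[OF P U] sym Usym by (simp add: P_def[symmetric])
    \<comment> \<open>The ranges of the two projections are orthogonal, so the mixed products vanish
      and \<open>P + U\<close> is again idempotent.\<close>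
    have PU: "P * U = 0\<^sub>m n n"
    proof (rule eq_matI)
      fix i j assume ij: "i < dim_row (0\<^sub>m n n :: real mat)" "j < dim_col (0\<^sub>m n n :: real mat)"
      then have "(P * U) $$ (i,j) = (P *\<^sub>v u) $ i * u $ j / c"
        using P u by (auto simp: U_def scalar_prod_def sum_distrib_right sum_divide_distrib mult.assoc
            intro!: sum.cong)
      then show "(P * U) $$ (i,j) = 0\<^sub>m n n $$ (i,j)" using ij by (simp add: Pu)
    qed (use P U in auto)
    have UP: "U * P = 0\<^sub>m n n"
    proof -
      have "U * P = transpose_mat (P * U)"
        using transpose_mult[OF P U] sym Usym by (simp add: P_def[symmetric])
      then show ?thesis by (simp add: PU)
    qed
    have UU: "U * U = U"
    proof (rule eq_matI)
      fix i j assume ij: "i < dim_row U" "j < dim_col U"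
      then have "(U * U) $$ (i,j) = (U *\<^sub>v u) $ i * u $ j / c"
        using U u by (auto simp: U_def scalar_prod_def sum_distrib_right sum_divide_distrib mult.assoc
            intro!: sum.cong)
      also have "U *\<^sub>v u = u" using Uv[OF u] c u by (simp add: c_def)
      finally show "(U * U) $$ (i,j) = U $$ (i,j)" using ij by (simp add: U_def)
    qed (use U in auto)
    have "(P + U) * (P + U) = P + U"
    proof -
      have "(P + U) * (P + U) = P * (P + U) + U * (P + U)"
        using P U by (intro add_mult_distrib_mat) auto
      also have "\<dots> = (P * P + P * U) + (U * P + U * U)"
        using P U by (simp add: mult_add_distrib_mat)
      also have "\<dots> = P + U"
        using P U idem by (simp add: PU UP UU P_def[symmetric])
      finally show ?thesis .
    qed
    then show ?thesis
      using G W fx tsym by (intro bexI[of _ "G + W"]) (auto simp: AG)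
  qed
qed

text \<open>After all \<open>n\<close> columns the projection \<open>A * G\<close> fixes every
  column of \<open>A\<close>, which is \<open>A * G * A = A\<close>. Existence makes the
  \<open>SOME\<close> in \<open>c_criterion\<close> denote a genuine generalized inverse.\<close>

lemma gen_inverse_exists:
  assumes A: "A \<in> carrier_mat n n"
  shows "\<exists>G. gen_inverse A G"
proof -
  obtain G where G: "G \<in> carrier_mat n n" and f: "\<And>i. i < n \<Longrightarrow> (A * G) *\<^sub>v col A i = col A i"
    using partial_gen_inverse[OF A order.refl] by auto
  have "A * G * A = A"
  proof (rule eq_matI)
    fix i j assume ij: "i < dim_row A" "j < dim_col A"
    then have "(A * G * A) $$ (i,j) = ((A * G) *\<^sub>v col A j) $ i"
      using A G by auto
    then show "(A * G * A) $$ (i,j) = A $$ (i,j)" using ij A by (simp add: f)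
  qed (use A G in auto)
  then show ?thesis using A G by (auto simp: gen_inverse_def)
qed

text \<open>Symmetry moves one factor \<open>A\<close> across the scalar product, and
  \<open>A * G * A = A\<close> then absorbs \<open>G\<close>. The right-hand side shows that the
  value does not depend on the choice of \<open>G\<close>.\<close>

lemma gen_inverse_quadratic_form:
  fixes A :: "real mat"
  assumes A: "A \<in> carrier_mat n n" and sym: "transpose_mat A = A"
    and G: "gen_inverse A G" and z: "z \<in> carrier_vec n"
  shows "scalar_prod (A *\<^sub>v z) (G *\<^sub>v (A *\<^sub>v z)) = scalar_prod (A *\<^sub>v z) z"
proof -
  have Gc: "G \<in> carrier_mat n n" and AGA: "A * G * A = A" using G A by (auto simp: gen_inverse_def)
  have "scalar_prod (A *\<^sub>v z) (G *\<^sub>v (A *\<^sub>v z)) = scalar_prod z (A *\<^sub>v (G *\<^sub>v (A *\<^sub>v z)))"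
    using transpose_vec_mult_scalar[OF A, of "G *\<^sub>v (A *\<^sub>v z)" z] sym A Gc z
    by (simp add: comm_scalar_prod[of _ n])
  also have "A *\<^sub>v (G *\<^sub>v (A *\<^sub>v z)) = (A * G * A) *\<^sub>v z"
    using A Gc z
    by (metis assoc_mult_mat_vec mult_carrier_mat mult_mat_vec_carrier)
  finally show ?thesis using AGA A z by (simp add: comm_scalar_prod[of _ n])
qed

section \<open>Evaluating the optimality criterion\<close>

lemma info_mat_carrier [simp]: "info_mat k \<xi> \<in> carrier_mat k k"
  by (simp add: info_mat_def)

lemma info_mat_sym: "transpose_mat (info_mat k \<xi>) = info_mat k \<xi>"
  by (rule eq_matI) (auto simp: info_mat_def mult.commute)

text \<open>An ordinary inverse is also a generalized inverse, so both finite branches of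
  \<open>c_criterion\<close> reduce to the same quadratic form. Any solution \<open>z\<close> of M z
  = c then gives the value without inverting a matrix.\<close>

lemma c_criterion_eq:
  assumes z: "z \<in> carrier_vec k" and c: "info_mat k \<xi> *\<^sub>v z = c"
  shows "c_criterion k c \<xi> = ereal (scalar_prod c z)"
proof (cases "mat_inverse (info_mat k \<xi>)")
  case None
  have "gen_inverse (info_mat k \<xi>) (SOME G. gen_inverse (info_mat k \<xi>) G)"
    by (rule someI_ex[OF gen_inverse_exists[OF info_mat_carrier]])
  from gen_inverse_quadratic_form[OF info_mat_carrier info_mat_sym this z]
  show ?thesis using None z c by (auto simp: c_criterion_def Let_def)
next
  case (Some N)
  note N = mat_inverse(2)[OF info_mat_carrier Some]
  then have "gen_inverse (info_mat k \<xi>) N"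
    by (auto simp: gen_inverse_def left_mult_one_mat[OF info_mat_carrier])
      (metis carrier_matD info_mat_carrier)+
  from gen_inverse_quadratic_form[OF info_mat_carrier info_mat_sym this z]
  show ?thesis using Some z c by (auto simp: c_criterion_def Let_def)
qed

text \<open>An inverse \<open>N\<close> would provide the solution \<open>N *\<^sub>v c\<close>, so
  only the infinite branch remains.\<close>

lemma c_criterion_infinite:
  assumes c: "c \<in> carrier_vec k" and "\<nexists>z. z \<in> carrier_vec k \<and> info_mat k \<xi> *\<^sub>v z = c"
  shows "c_criterion k c \<xi> = \<infinity>"
proof (cases "mat_inverse (info_mat k \<xi>)")
  case None
  then show ?thesis using assms by (auto simp: c_criterion_def Let_def)
next
  case (Some N)
  note N = mat_inverse(2)[OF info_mat_carrier Some]
  then have "info_mat k \<xi> *\<^sub>v (N *\<^sub>v c) = c"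
    using c by (subst assoc_mult_mat_vec[OF info_mat_carrier, symmetric]) auto
  then show ?thesis using assms N by (meson mult_mat_vec_carrier)
qed

section \<open>Chebyshev polynomials at their extremal points\<close>

lemma cheb_T_cos: "cheb_T n (cos t) = cos (real n * t)"
proof (induction n "cos t" rule: cheb_T.induct)
  case (3 n)
  have "cos (real (Suc (Suc n)) * t) = cos (real (Suc n) * t + t)" 
    by (simp add: algebra_simps)
  moreover have "cos (real n * t) = cos (real (Suc n) * t - t)" by (simp add: algebra_simps)
  ultimately have "cos (real (Suc (Suc n)) * t) + cos (real n * t) = 2 * cos t * cos (real (Suc n) * t)"
    by (simp only: cos_add cos_diff) (simp add: algebra_simps)
  then show ?case using 3 by simp
qed auto

text \<open>The exact degree matters later: it makes the leading coefficient nonzero, and being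
  nonzero leaves only finitely many roots.\<close>

lemma cheb_T_poly: "\<exists>p. degree p = n \<and> p \<noteq> 0 \<and> (\<forall>x. poly p x = cheb_T n x)"
proof (induction n rule: cheb_T.induct[of "\<lambda>n _. \<exists>p. degree p = n \<and> p \<noteq> 0 \<and> (\<forall>x. poly p x = cheb_T n x)", case_names 0 1 2])
  case (0 x)
  show ?case by (rule exI[of _ 1]) simp
next
  case (1 x)
  show ?case by (rule exI[of _ "[:0,1:]"]) simp
next
  case (2 n x)
  then obtain p q where p: "degree p = Suc n" "p \<noteq> 0" "\<And>x. poly p x = cheb_T (Suc n) x"
    and q: "degree q = n" "\<And>x. poly q x = cheb_T n x" by metis
  have "degree ([:0,2:] * p) = Suc (Suc n)" using p by (subst degree_mult_eq) auto
  then have "degree ([:0,2:] * p + (- q)) = Suc (Suc n)"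
    using q by (subst degree_add_eq_left) auto
  moreover from this have "[:0,2:] * p + (- q) \<noteq> 0" by (metis degree_0 nat.distinct(1))
  ultimately show ?case
    by (intro exI[of _ "[:0,2:] * p + (- q)"]) (simp add: p q algebra_simps)
qed

lemma cheb_T_abs_le_1:
  assumes "x \<in> {-1..1}"
  shows "\<bar>cheb_T n x\<bar> \<le> 1"
  using cheb_T_cos[of n "arccos x"] assms by (simp add: cos_arccos)

text \<open>The product-to-sum formula for cosines, here for all real \<open>x\<close>: both sides
  satisfy the Chebyshev recurrence in \<open>m\<close>.\<close>

lemma cheb_T_mult:
  assumes "m \<le> n"
  shows "cheb_T n x * cheb_T m x = (cheb_T (n + m) x + cheb_T (n - m) x) / 2"
  using assms
proof (induction m arbitrary: rule: less_induct)
  case (less m)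
  consider "m = 0" | "m = 1" | l where "m = Suc (Suc l)" by (metis One_nat_def old.nat.exhaust)
  then show ?case
  proof cases
    case 2
    then obtain j where "n = Suc j" using less.prems by (cases n) auto
    with 2 show ?thesis by simp
  next
    case 3
    then obtain j where n: "n = Suc (Suc (l + j))"
      using less.prems by (metis add_Suc le_Suc_ex)
    have "cheb_T n x * cheb_T (Suc l) x = (cheb_T (n + Suc l) x + cheb_T (n - Suc l) x) / 2"
      using less.IH[of "Suc l"] 3 less.prems by simp
    moreover have "cheb_T n x * cheb_T l x = (cheb_T (n + l) x + cheb_T (n - l) x) / 2"
      using less.IH[of l] 3 less.prems by simp
    moreover have "cheb_T (n - l) x = 2 * x * cheb_T (n - Suc l) x - cheb_T (n - m) x"
      by (simp add: n 3)
    moreover have "cheb_T (n + m) x = 2 * x * cheb_T (n + Suc l) x - cheb_T (n + l) x"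
      by (simp add: n 3)
    moreover have "cheb_T n x * cheb_T m x = 2 * x * (cheb_T n x * cheb_T (Suc l) x) - cheb_T n x * cheb_T l x"
      by (simp add: 3 algebra_simps)
    ultimately show ?thesis by (simp add: algebra_simps add_divide_distrib)
  qed auto
qed

lemma continuous_on_cheb_T: "continuous_on S (cheb_T n)"
proof -
  obtain p where "\<And>x. poly p x = cheb_T n x" using cheb_T_poly by blast
  then have "cheb_T n = poly p" by auto
  then show ?thesis by (simp add: continuous_on_poly)
qed

text \<open>The sum telescopes: 2 sin(h/2) times one trapezoid term is cos(h/2) times the difference
  of the sines at its two ends.\<close>

lemma sin_half_mult_trapezoid_cos:
  "2 * sin (h / 2) * (\<Sum>l<n. (cos (real l * h) + cos (real (Suc l) * h)) / 2) = cos (h / 2) * sin (real n * h)"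
proof (induction n)
  case (Suc n)
  define m where "m = real n * h + h / 2"
  have e: "real n * h = m - h / 2" "real (Suc n) * h = m + h / 2"
    by (auto simp: m_def field_simps)
  have "2 * sin (h / 2) * ((cos (real n * h) + cos (real (Suc n) * h)) / 2)
      = cos (h / 2) * (sin (real (Suc n) * h) - sin (real n * h))"
    unfolding e by (simp add: sin_add sin_diff cos_add cos_diff)
  with Suc show ?case unfolding sum.lessThan_Suc distrib_left[of _ "sum _ _"] right_diff_distrib by linarith
qed simp

text \<open>The halved end weights are those of the composite trapezoidal rule.\<close>

lemma sum_nu:
  assumes "k \<ge> 2"
  shows "(\<Sum>i<k. nu k i * f i) = (\<Sum>i<k-1. (f i + f (Suc i)) / 2)"
proof -
  obtain n where k: "k = Suc (Suc n)" using assms by (metis add_2_eq_Suc le_Suc_ex)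
  have "(\<Sum>i<k. nu k i * f i) = f 0 / 2 + (\<Sum>i<n. f (Suc i)) + f (Suc n) / 2"
  proof -
    have "(\<Sum>i<k. nu k i * f i) = nu k 0 * f 0 + (\<Sum>i<n. nu k (Suc i) * f (Suc i)) + nu k (Suc n) * f (Suc n)"
      unfolding k sum.lessThan_Suc_shift[of _ "Suc n"] sum.lessThan_Suc[of _ n] by simp
    moreover have "(\<Sum>i<n. nu k (Suc i) * f (Suc i)) = (\<Sum>i<n. f (Suc i))"
      by (intro sum.cong) (auto simp: nu_def k)
    ultimately show ?thesis by (simp add: nu_def k)
  qed
  moreover have "(\<Sum>i<m. (f i + f (Suc i)) / 2) = f 0 / 2 + (\<Sum>i<m. f (Suc i)) - f m / 2" for m
    by (induction m) (auto simp: field_simps)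
  from this[of "Suc n"] have "(\<Sum>i<k-1. (f i + f (Suc i)) / 2) = f 0 / 2 + (\<Sum>i<n. f (Suc i)) + f (Suc n) / 2"
    by (simp add: k field_simps)
  ultimately show ?thesis by simp
qed

text \<open>The weights are symmetric under reflection of the index. This is needed because the
  nodes increase with \<open>i\<close> while their angles decrease.\<close>

lemma sum_nu_rev:
  assumes "k \<ge> 2"
  shows "(\<Sum>i<k. nu k i * f (k - 1 - i)) = (\<Sum>i<k. nu k i * f i)"
proof -
  have "(\<Sum>i<k. nu k i * f i) = (\<Sum>i<k. nu k (k - Suc i) * f (k - Suc i))"
    by (rule sum.nat_diff_reindex[symmetric])
  also have "\<dots> = (\<Sum>i<k. nu k i * f (k - 1 - i))"
    using assms by (intro sum.cong) (auto simp: nu_def)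
  finally show ?thesis ..
qed

text \<open>The values of \<open>cheb_T a\<close> at the nodes are cosines of equally spaced angles
  with step \<open>h\<close>, so the sum is a trapezoidal sum of cosines. Unless all its terms are
  1, the telescoped form makes it vanish.\<close>

lemma sum_nu_cheb_T_node:
  assumes k: "k \<ge> 2"
  shows "(\<Sum>i<k. nu k i * cheb_T a (node k i)) = (if 2 * (k - 1) dvd a then real k - 1 else 0)"
proof -
  define n where "n = k - 1"
  have n: "n > 0" "real k - 1 = real n" using k by (auto simp: n_def)
  define h where "h = pi * real a / real n"
  have node: "cheb_T a (node k i) = cos (real (k - 1 - i) * h)" if "i < k" for i
    unfolding node_def cheb_T_cos h_def n(2) using that k
    by (simp add: of_nat_diff n_def algebra_simps)
  define S where "S = (\<Sum>l<n. (cos (real l * h) + cos (real (Suc l) * h)) / 2)"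
  have "(\<Sum>i<k. nu k i * cheb_T a (node k i)) = (\<Sum>i<k. nu k i * cos (real (k - 1 - i) * h))"
    by (intro sum.cong) (auto simp: node)
  also have "\<dots> = (\<Sum>i<k. nu k i * cos (real i * h))"
    by (rule sum_nu_rev[OF k])
  also have "\<dots> = S" by (subst sum_nu[OF k]) (simp add: S_def n_def)
  also have "S = (if 2 * n dvd a then real n else 0)"
  proof (cases "2 * n dvd a")
    case True
    then obtain b where "a = 2 * n * b" by (auto simp: dvd_def)
    then have h: "h = 2 * pi * real b" using n by (simp add: h_def)
    have "cos (real l * h) = 1" for l
      using cos_int_2pin[of "int (l * b)"] by (simp add: h mult_ac)
    then have "(cos (real l * h) + cos (real (Suc l) * h)) / 2 = 1" for l by (metis add_divide_distrib field_sum_of_halves)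
    then show ?thesis using True by (simp add: S_def del: of_nat_Suc)
  next
    case False
    have "sin (h / 2) \<noteq> 0"
    proof
      assume "sin (h / 2) = 0"
      then obtain i :: int where "h / 2 = of_int i * pi" by (auto simp: sin_zero_iff_int2)
      then have "real a = 2 * real n * of_int i" using n by (simp add: h_def field_simps)
      then have "of_int (int a) = (of_int (2 * int n * i) :: real)" by simp
      then have "int a = int (2 * n) * i" by (subst (asm) of_int_eq_iff) simp
      then have "int (2 * n) dvd int a" by (metis dvd_triv_left)
      then show False using False by (simp only: of_nat_dvd_iff)
    qed
    \<comment> \<open>Here \<open>real n * h\<close> is \<open>pi * real a\<close>, an integer
      multiple of pi.\<close>
    moreover have "sin (real n * h) = 0" using n by (simp add: h_def sin_npi2)
    ultimately show ?thesis using sin_half_mult_trapezoid_cos[of h n] False by (simp add: S_def)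
  qed
  finally show ?thesis using n by (simp add: n_def)
qed

section \<open>Integration on the design space\<close>

text \<open>Only the values of \<open>\<xi>\<close> on measurable sets enter, so the lemma serves
  every measure that decomposes this way, whatever its construction. The proof is the standard
  induction on measurable functions; in the limit step the finite sum commutes with the supremum
  because the terms increase.\<close>

lemma nn_integral_weighted_sum_measure:
  fixes c :: "'i \<Rightarrow> ennreal"
  assumes fin: "finite I" and sets: "\<And>i. i \<in> I \<Longrightarrow> sets (\<mu> i) = sets \<xi>"
    and em: "\<And>A. A \<in> sets \<xi> \<Longrightarrow> emeasure \<xi> A = (\<Sum>i\<in>I. c i * emeasure (\<mu> i) A)"
    and f: "f \<in> borel_measurable \<xi>"
  shows "(\<integral>\<^sup>+x. f x \<partial>\<xi>) = (\<Sum>i\<in>I. c i * (\<integral>\<^sup>+x. f x \<partial>\<mu> i))"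
proof -
  have meas: "g \<in> borel_measurable (\<mu> i)" if "i \<in> I" "g \<in> borel_measurable \<xi>" for i and g :: "_ \<Rightarrow> ennreal"
    using that sets measurable_cong_sets by blast
  have sp: "space (\<mu> i) = space \<xi>" if "i \<in> I" for i by (rule sets_eq_imp_space_eq[OF sets[OF that]])
  show ?thesis
    using f
  proof (induction rule: borel_measurable_induct)
    case (cong f g)
    then have "(\<integral>\<^sup>+x. f x \<partial>\<mu> i) = (\<integral>\<^sup>+x. g x \<partial>\<mu> i)" if "i \<in> I" for i
      using sp[OF that] by (intro nn_integral_cong) auto
    moreover have "(\<integral>\<^sup>+x. f x \<partial>\<xi>) = (\<integral>\<^sup>+x. g x \<partial>\<xi>)" using cong by (intro nn_integral_cong) auto
    ultimately show ?case using cong by simp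
  next
    case (set A)
    then show ?case using sets by (simp add: em)
  next
    case (mult u c')
    then show ?case
      using meas by (simp add: nn_integral_cmult sum_distrib_left mult.left_commute)
  next
    case (add u v)
    then show ?case
      using meas by (simp add: nn_integral_add sum.distrib distrib_left)
  next
    case (seq U)
    have mc: "(\<integral>\<^sup>+x. (SUP n. U n) x \<partial>M) = (SUP n. \<integral>\<^sup>+x. U n x \<partial>M)"
      if "\<And>n. U n \<in> borel_measurable M" for M
      unfolding SUP_apply by (rule nn_integral_monotone_convergence_SUP[OF \<open>incseq U\<close> that])
    have "(\<integral>\<^sup>+x. (SUP n. U n) x \<partial>\<xi>) = (SUP n. \<Sum>i\<in>I. c i * (\<integral>\<^sup>+x. U n x \<partial>\<mu> i))"
      unfolding mc[OF seq(1)] seq.IH ..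
    also have "\<dots> = (\<Sum>i\<in>I. SUP n. c i * (\<integral>\<^sup>+x. U n x \<partial>\<mu> i))"
    proof (rule ennreal_SUP_sum)
      show "incseq (\<lambda>n. c i * (\<integral>\<^sup>+x. U n x \<partial>\<mu> i))" for i
        using \<open>incseq U\<close> by (intro monoI mult_left_mono nn_integral_mono) (auto dest: monoD le_funD)
    qed
    also have "\<dots> = (\<Sum>i\<in>I. c i * (\<integral>\<^sup>+x. (SUP n. U n) x \<partial>\<mu> i))"
      by (intro sum.cong refl) (simp only: mc[OF meas[OF _ seq(1)]] SUP_mult_left_ennreal)
    finally show ?case .
  qed
qed

text \<open>The nonnegative version is applied to the positive and the negative part of
  \<open>f\<close>. Integrability under each \<open>\<mu> i\<close> keeps all these integrals
  finite, so \<open>enn2real\<close> loses nothing.\<close>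

lemma integral_weighted_sum_measure:
  fixes f :: "'a \<Rightarrow> real" and c :: "'i \<Rightarrow> real"
  assumes fin: "finite I" and sets: "\<And>i. i \<in> I \<Longrightarrow> sets (\<mu> i) = sets \<xi>"
    and em: "\<And>A. A \<in> sets \<xi> \<Longrightarrow> emeasure \<xi> A = (\<Sum>i\<in>I. ennreal (c i) * emeasure (\<mu> i) A)"
    and c: "\<And>i. i \<in> I \<Longrightarrow> 0 \<le> c i"
    and int: "\<And>i. i \<in> I \<Longrightarrow> integrable (\<mu> i) f" and f [measurable]: "f \<in> borel_measurable \<xi>"
  shows "integrable \<xi> f" "(\<integral>x. f x \<partial>\<xi>) = (\<Sum>i\<in>I. c i * (\<integral>x. f x \<partial>\<mu> i))"
proof -
  have nn: "(\<integral>\<^sup>+x. ennreal (g x) \<partial>\<xi>) = ennreal (\<Sum>i\<in>I. c i * enn2real (\<integral>\<^sup>+x. ennreal (g x) \<partial>\<mu> i))"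
    if "g \<in> borel_measurable \<xi>" "\<And>i. i \<in> I \<Longrightarrow> integrable (\<mu> i) g" for g :: "'a \<Rightarrow> real"
  proof -
    have "(\<integral>\<^sup>+x. ennreal (g x) \<partial>\<xi>) = (\<Sum>i\<in>I. ennreal (c i) * (\<integral>\<^sup>+x. ennreal (g x) \<partial>\<mu> i))"
      using that(1) by (intro nn_integral_weighted_sum_measure[OF fin sets em]) auto
    also have "\<dots> = (\<Sum>i\<in>I. ennreal (c i * enn2real (\<integral>\<^sup>+x. ennreal (g x) \<partial>\<mu> i)))"
      using that(2) c by (intro sum.cong refl)
        (auto simp: ennreal_mult real_integrable_def less_top ennreal_enn2real)
    also have "\<dots> = ennreal (\<Sum>i\<in>I. c i * enn2real (\<integral>\<^sup>+x. ennreal (g x) \<partial>\<mu> i))"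
      using c by (intro sum_ennreal) auto
    finally show ?thesis .
  qed
  have nnf: "(\<integral>\<^sup>+x. ennreal (f x) \<partial>\<xi>) = ennreal (\<Sum>i\<in>I. c i * enn2real (\<integral>\<^sup>+x. ennreal (f x) \<partial>\<mu> i))"
    and nnf': "(\<integral>\<^sup>+x. ennreal (- f x) \<partial>\<xi>) = ennreal (\<Sum>i\<in>I. c i * enn2real (\<integral>\<^sup>+x. ennreal (- f x) \<partial>\<mu> i))"
    using nn[of f] nn[of "\<lambda>x. - f x"] int f by auto
  show i: "integrable \<xi> f" using f nnf nnf' by (simp add: real_integrable_def)
  show "(\<integral>x. f x \<partial>\<xi>) = (\<Sum>i\<in>I. c i * (\<integral>x. f x \<partial>\<mu> i))"
    unfolding real_lebesgue_integral_def[OF i] nnf nnf' using c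
    by (simp add: real_lebesgue_integral_def[OF int] sum_nonneg sum_subtractf right_diff_distrib)
qed

lemma integral_scale_measure:
  fixes f :: "'a \<Rightarrow> real"
  assumes "0 \<le> c" "integrable M f"
  shows "integrable (scale_measure (ennreal c) M) f"
    "(\<integral>x. f x \<partial>scale_measure (ennreal c) M) = c * (\<integral>x. f x \<partial>M)"
  using integral_weighted_sum_measure[of "{()}" "\<lambda>_. M" "scale_measure (ennreal c) M" "\<lambda>_. c" f] assms
  by auto

lemma half_ennreal: "(1/2 :: ennreal) = ennreal (1/2)"
  by (simp add: divide_ennreal_def ennreal_divide_numeral)

section \<open>Continuous integrands on [-1,1]\<close>

lemma space_leb_I [simp]: "space leb_I = {-1..1}"
  by (simp add: leb_I_def space_restrict_space)

lemma sets_unif_I [simp]: "sets unif_I = sets leb_I" and space_unif_I [simp]: "space unif_I = {-1..1}"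
  by (simp_all add: unif_I_def space_scale_measure)

lemma borel_measurable_leb_I:
  assumes "continuous_on {-1..1} h"
  shows "h \<in> borel_measurable leb_I"
proof -
  have "h \<in> borel_measurable (restrict_space borel {-1..1})"
    by (rule borel_measurable_continuous_on_restrict[OF assms])
  moreover have "sets (restrict_space borel {-1..1::real}) = sets leb_I"
    unfolding leb_I_def by (rule sets_restrict_space_cong) simp
  ultimately show ?thesis using measurable_cong_sets by blast
qed

lemma continuous_bounded_I:
  fixes h :: "real \<Rightarrow> real"
  assumes "continuous_on {-1..1} h"
  obtains B where "\<And>x. x \<in> {-1..1} \<Longrightarrow> \<bar>h x\<bar> \<le> B"
proof -
  have "bounded (h ` {-1..1})"
    by (rule compact_imp_bounded[OF compact_continuous_image[OF assms]]) simp
  then obtain B where "\<forall>x\<in>{-1..1}. \<bar>h x\<bar> \<le> B" by (auto simp: bounded_iff)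
  then show ?thesis using that by blast
qed

lemma integrable_continuous_I:
  fixes h :: "real \<Rightarrow> real"
  assumes "finite_measure \<xi>" "sets \<xi> = sets leb_I" "continuous_on {-1..1} h"
  shows "integrable \<xi> h"
proof -
  obtain B where B: "\<And>x. x \<in> {-1..1} \<Longrightarrow> \<bar>h x\<bar> \<le> B" using continuous_bounded_I[OF assms(3)] by blast
  have "space \<xi> = {-1..1}" using sets_eq_imp_space_eq[OF assms(2)] by simp
  then show ?thesis
    using B borel_measurable_leb_I[OF assms(3)] measurable_cong_sets[OF assms(2) refl]
    by (intro finite_measure.integrable_const_bound[OF assms(1), of _ B]) auto
qed

lemma integral_leb_I: "(\<integral>x. f x \<partial>leb_I) = (LBINT x:{-1..1}. f x)" for f :: "real \<Rightarrow> real"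
  by (simp add: leb_I_def integral_restrict_space set_lebesgue_integral_def)

lemma integrable_leb_I_times:
  fixes v h :: "real \<Rightarrow> real"
  assumes v: "integrable leb_I v" and h: "continuous_on {-1..1} h"
  shows "integrable leb_I (\<lambda>x. h x * v x)"
proof -
  obtain B where B: "\<And>x. x \<in> {-1..1} \<Longrightarrow> \<bar>h x\<bar> \<le> B" using continuous_bounded_I[OF h] by blast
  have [measurable]: "h \<in> borel_measurable leb_I" "v \<in> borel_measurable leb_I"
    using borel_measurable_leb_I[OF h] v by auto
  show ?thesis
  proof (rule Bochner_Integration.integrable_bound[OF integrable_mult_right[OF integrable_abs[OF v], of B]])
    show "AE x in leb_I. norm (h x * v x) \<le> norm (B * \<bar>v x\<bar>)"
    proof (rule AE_I2)
      fix x assume "x \<in> space leb_I"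
      then have "\<bar>h x\<bar> * \<bar>v x\<bar> \<le> B * \<bar>v x\<bar>" "0 \<le> B" using B[of x] by (auto intro!: mult_right_mono)
      then show "norm (h x * v x) \<le> norm (B * \<bar>v x\<bar>)" by (simp add: abs_mult)
    qed
  qed measurable
qed

section \<open>Integration against a weight function\<close>

context
  fixes v :: "real \<Rightarrow> real"
  assumes v: "weight_fun v"
begin

lemma weight_fun_nonneg: "x \<in> {-1..1} \<Longrightarrow> 0 \<le> v x"
  using v by (simp add: weight_fun_def)

text \<open>The integral of a non-integrable function is 0 by default, so the normalization to 1
  already forces integrability, and with it measurability.\<close>

lemma weight_fun_integrable: "integrable leb_I v"
proof -
  have "integrable unif_I v" using v not_integrable_integral_eq[of unif_I v] by (auto simp: weight_fun_def)
  then show ?thesis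
    by (auto simp: real_integrable_def unif_I_def nn_integral_scale_measure ennreal_mult_eq_top_iff)
qed

lemma weight_fun_measurable [measurable]: "v \<in> borel_measurable leb_I" "v \<in> borel_measurable unif_I"
  using weight_fun_integrable by (auto simp: unif_I_def)

lemma integral_leb_I_weight_fun: "(\<integral>x. v x \<partial>leb_I) = 2"
  using v integral_scale_measure(2)[of "1/2" leb_I v] weight_fun_integrable
  by (simp add: weight_fun_def unif_I_def divide_ennreal_def ennreal_divide_numeral)

lemma integral_density_unif_I:
  assumes h: "continuous_on {-1..1} h"
  shows "integrable (density unif_I (\<lambda>x. ennreal (v x))) h"
    "(\<integral>x. h x \<partial>density unif_I (\<lambda>x. ennreal (v x))) = (LBINT x:{-1..1}. h x * v x) / 2"
proof -
  have hm: "h \<in> borel_measurable unif_I" using borel_measurable_leb_I[OF h] by (simp add: unif_I_def)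
  note int = integral_scale_measure[OF _ integrable_leb_I_times[OF weight_fun_integrable h], of "1/2"]
  have nn: "AE x in unif_I. 0 \<le> v x" by (rule AE_I2) (simp add: weight_fun_nonneg)
  show "integrable (density unif_I (\<lambda>x. ennreal (v x))) h"
    using int(1) by (subst integrable_density[OF hm weight_fun_measurable(2) nn]) (simp add: unif_I_def half_ennreal mult.commute)
  show "(\<integral>x. h x \<partial>density unif_I (\<lambda>x. ennreal (v x))) = (LBINT x:{-1..1}. h x * v x) / 2"
    using int(2) by (subst integral_density[OF hm weight_fun_measurable(2) nn])
      (simp add: unif_I_def half_ennreal mult.commute integral_leb_I)
qed

lemma prob_space_density_unif_I: "prob_space (density unif_I (\<lambda>x. ennreal (v x)))"
proof
  have "emeasure (density unif_I (\<lambda>x. ennreal (v x))) (space unif_I)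
      = (\<integral>\<^sup>+x. ennreal (v x) * indicator (space unif_I) x \<partial>unif_I)"
    using weight_fun_measurable(2) by (intro emeasure_density sets.top) simp
  also have "\<dots> = (\<integral>\<^sup>+x. ennreal (v x) \<partial>unif_I)"
    by (intro nn_integral_cong) simp
  also have "\<dots> = ennreal (1/2) * (\<integral>\<^sup>+x. ennreal (v x) \<partial>leb_I)"
    unfolding unif_I_def half_ennreal using weight_fun_measurable(1) by (intro nn_integral_scale_measure) auto
  also have "(\<integral>\<^sup>+x. ennreal (v x) \<partial>leb_I) = ennreal 2"
    using nn_integral_eq_integral[OF weight_fun_integrable AE_I2] weight_fun_nonneg
    by (simp add: integral_leb_I_weight_fun)
  also have "ennreal (1/2) * ennreal 2 = ennreal (1/2 * 2)"
    by (rule ennreal_mult[symmetric]) simp_all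
  finally show "emeasure (density unif_I (\<lambda>x. ennreal (v x))) (space (density unif_I (\<lambda>x. ennreal (v x)))) = 1"
    by (simp del: space_unif_I)
qed

end

lemma node_in_I: "node k i \<in> {-1..1}"
  by (simp add: node_def)

text \<open>The angles lie between 0 and pi, where the cosine is injective. This is needed because
  \<open>designs\<close> attaches masses to points, whereas \<open>opt_design\<close> attaches them
  to indices.\<close>

lemma inj_on_node:
  assumes "k \<ge> 2"
  shows "inj_on (node k) {..<k}"
proof
  define \<theta> where "\<theta> l = pi * ((real k - 1 - real l) / (real k - 1))" for l
  fix i j assume ij: "i \<in> {..<k}" "j \<in> {..<k}" and eq: "node k i = node k j"
  have \<theta>: "0 \<le> \<theta> l" "\<theta> l \<le> pi" if "l \<in> {..<k}" for l
  proof -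
    have "0 \<le> (real k - 1 - real l) / (real k - 1)" "(real k - 1 - real l) / (real k - 1) \<le> 1"
      using that assms by auto
    then show "0 \<le> \<theta> l" "\<theta> l \<le> pi"
      unfolding \<theta>_def using mult_left_mono[of _ 1 pi] by (simp_all only: mult_nonneg_nonneg pi_ge_zero mult_1_right)
  qed
  have "cos (\<theta> i) = cos (\<theta> j)" using eq by (simp add: node_def \<theta>_def)
  then have "\<theta> i = \<theta> j"
    by (rule cos_inj_pi[OF \<theta>[OF ij(1)] \<theta>[OF ij(2)]])
  then have "(real k - 1 - real i) / (real k - 1) = (real k - 1 - real j) / (real k - 1)"
    unfolding \<theta>_def using mult_cancel_left[of pi] pi_neq_zero by blast
  moreover have "real k - 1 \<noteq> 0" using assms by simp
  ultimately have "real k - 1 - real i = real k - 1 - real j"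
    by (simp only: divide_cancel_right) blast
  then show "i = j" by simp
qed

section \<open>The quadrature weights and the optimal design\<close>

text \<open>With truncated subtraction, \<open>(j - s) + (s - j)\<close> is the distance of
  \<open>j\<close> and \<open>s\<close>, which removes the case distinction from the product
  formula.\<close>

lemma cheb_T_mult':
  "cheb_T j x * cheb_T s x = (cheb_T (j + s) x + cheb_T ((j - s) + (s - j)) x) / 2"
  using cheb_T_mult[of s j x] cheb_T_mult[of j s x] by (cases "s \<le> j") (auto simp: ac_simps)

text \<open>After the product formula only multiples of 2(k-1) among the sum and the distance of the
  indices contribute. The sum is below 4(k-1), so it can be 0 or 2(k-1), the latter being the
  aliasing case; the distance can only be 0.\<close>

lemma sum_nu_cheb_T_mult_node:
  assumes k: "k \<ge> 2" and "j < 2 * (k - 1)" "s < 2 * (k - 1)"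
  shows "(\<Sum>i<k. nu k i * (cheb_T j (node k i) * cheb_T s (node k i)))
    = (real k - 1) / 2 * (of_bool (j + s = 0 \<or> j + s = 2 * (k - 1)) + of_bool (j = s))"
proof -
  have "2 * (k - 1) dvd j + s \<longleftrightarrow> j + s = 0 \<or> j + s = 2 * (k - 1)"
  proof
    assume "2 * (k - 1) dvd j + s"
    then obtain b where b: "j + s = 2 * (k - 1) * b" by (auto simp: dvd_def)
    have "2 * (k - 1) * b < 2 * (k - 1) * 2" using assms b by linarith
    then have "b < 2" by simp
    then show "j + s = 0 \<or> j + s = 2 * (k - 1)" using b by (auto simp: less_2_cases_iff)
  qed auto
  moreover have "2 * (k - 1) dvd (j - s) + (s - j) \<longleftrightarrow> j = s"
    using assms by (auto dest!: dvd_imp_le)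
  moreover have "(\<Sum>i<k. nu k i * (cheb_T j (node k i) * cheb_T s (node k i)))
    = ((\<Sum>i<k. nu k i * cheb_T (j + s) (node k i)) + (\<Sum>i<k. nu k i * cheb_T ((j - s) + (s - j)) (node k i))) / 2"
    by (simp add: cheb_T_mult' sum.distrib sum_divide_distrib distrib_left add_divide_distrib)
  ultimately show ?thesis
    unfolding sum_nu_cheb_T_node[OF k] by (simp add: of_bool_def field_simps)
qed

lemma q_weight_altdef:
  assumes k: "k \<ge> 2"
  shows "q_weight k v i = nu k i / (2 * (real k - 1)) *
    (\<Sum>j<2 * (k - 1). cheb_T j (node k i) * (LBINT x:{-1..1}. cheb_T j x * v x))"
proof -
  have "{0..2 * k - 3} = {..<2 * (k - 1)}" using k by auto
  then show ?thesis
    by (simp add: q_weight_def node_def cheb_T_cos mult_ac)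
qed

text \<open>The nodes cannot tell T_s from T_{2(k-1)-s}, so the quadrature returns the mean of the
  two moments. It is exact for \<open>s = 0\<close> and for \<open>s = k - 1\<close>. A moment with
  respect to \<open>v\<close> times \<open>unif_I\<close> is half the Lebesgue integral, whence the
  denominators 2 and 4.\<close>

lemma sum_q_weight_cheb_T_node:
  assumes k: "k \<ge> 2" and s: "s < 2 * (k - 1)"
  shows "(\<Sum>i<k. q_weight k v i * cheb_T s (node k i)) =
    (if s = 0 then (LBINT x:{-1..1}. cheb_T 0 x * v x) / 2
     else ((LBINT x:{-1..1}. cheb_T s x * v x) + (LBINT x:{-1..1}. cheb_T (2 * (k - 1) - s) x * v x)) / 4)"
proof -
  define C where "C j = (LBINT x:{-1..1}. cheb_T j x * v x)" for j
  have k0: "real k - 1 \<noteq> 0" using k by simp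
  have "(\<Sum>i<k. q_weight k v i * cheb_T s (node k i))
    = (\<Sum>i<k. \<Sum>j<2 * (k - 1). C j / (2 * (real k - 1)) * (nu k i * (cheb_T j (node k i) * cheb_T s (node k i))))"
    by (simp add: q_weight_altdef[OF k] C_def sum_distrib_left sum_distrib_right mult_ac)
  also have "\<dots> = (\<Sum>j<2 * (k - 1). C j / (2 * (real k - 1)) * (\<Sum>i<k. nu k i * (cheb_T j (node k i) * cheb_T s (node k i))))"
    by (subst sum.swap) (simp add: sum_distrib_left)
  also have "\<dots> = (\<Sum>j<2 * (k - 1). C j / 4 * of_bool (j + s = 0 \<or> j + s = 2 * (k - 1)) + C j / 4 * of_bool (j = s))"
    using s k0 by (intro sum.cong refl, subst sum_nu_cheb_T_mult_node[OF k]) (auto simp: field_simps)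
  \<comment> \<open>Each indicator selects a single \<open>j\<close>. For \<open>s = 0\<close> the
    aliasing partner 2(k-1) is outside the range, and both indicators select
    \<open>j = 0\<close>.\<close>
  also have "\<dots> = (\<Sum>j<2 * (k - 1). if j = (if s = 0 then 0 else 2 * (k - 1) - s) then C j / 4 else 0)
      + (\<Sum>j<2 * (k - 1). if j = s then C j / 4 else 0)"
    unfolding sum.distrib using s by (intro arg_cong2[where f = "(+)"] sum.cong refl) auto
  also have "\<dots> = (if s = 0 then C 0 / 2 else (C s + C (2 * (k - 1) - s)) / 4)"
    using s by (simp add: add_divide_distrib)
  finally show ?thesis by (simp only: C_def)
qed

lemma sum_q_weight:
  assumes "k \<ge> 2" "weight_fun v"
  shows "(\<Sum>i<k. q_weight k v i) = 1"
  using sum_q_weight_cheb_T_node[of k 0 v] assms integral_leb_I_weight_fun[of v]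
  by (simp add: integral_leb_I)

text \<open>The point masses complete the mass \<open>r\<close> of the continuous part to 1. Once
  they are known to be nonnegative, this also yields that \<open>r\<close> is at most 1.\<close>

lemma sum_p_weight:
  assumes "k \<ge> 2" "weight_fun v"
  shows "(\<Sum>i<k. p_weight k v r i) = 1 - r"
  using sum_nu_cheb_T_node[of k 0] sum_q_weight[of k v] assms
  by (simp add: p_weight_def sum_subtractf flip: sum_divide_distrib sum_distrib_left)

text \<open>For positive \<open>q_weight\<close> the bound by \<open>alpha0\<close> is exactly the
  required inequality; otherwise the subtracted term is not positive.\<close>

lemma p_weight_nonneg:
  assumes k: "k \<ge> 2" and r: "r \<in> {0..alpha0 k v}" and i: "i < k"
  shows "0 \<le> p_weight k v r i"
proof (cases "q_weight k v i > 0")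
  case True
  have "alpha0 k v \<le> nu k i / ((real k - 1) * q_weight k v i)"
    unfolding alpha0_def using i True by (intro Min_le) auto
  then have "r \<le> nu k i / ((real k - 1) * q_weight k v i)" using r by simp
  moreover have "0 < real k - 1" using k by simp
  ultimately show ?thesis using True by (simp add: p_weight_def field_simps)
next
  case False
  then have "r * q_weight k v i \<le> 0" using r by (simp add: mult_nonneg_nonpos)
  moreover have "0 \<le> nu k i / (real k - 1)" using k by (simp add: nu_def)
  ultimately show ?thesis by (simp add: p_weight_def)
qed

section \<open>The measure \<open>opt_design\<close> and its membership among the competing
  designs\<close>

lemma emeasure_opt_design:
  assumes "A \<in> sets leb_I"
  shows "emeasure (opt_design k v r) A =
    ennreal r * emeasure (density unif_I (\<lambda>x. ennreal (v x))) A
    + (\<Sum>i<k. ennreal (p_weight k v r i) * emeasure (return leb_I (node k i)) A)"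
  using assms unfolding opt_design_def
  by (subst emeasure_measure_plus) (auto simp: emeasure_measure_sum)

lemma sets_opt_design [simp]: "sets (opt_design k v r) = sets leb_I"
  by (simp add: opt_design_def)

lemma space_opt_design [simp]: "space (opt_design k v r) = {-1..1}"
  using sets_eq_imp_space_eq[OF sets_opt_design] by simp

lemma integral_opt_design:
  assumes v: "weight_fun v" and r: "0 \<le> r" and p: "\<And>i. i < k \<Longrightarrow> 0 \<le> p_weight k v r i"
    and h: "continuous_on {-1..1} h"
  shows "(\<integral>x. h x \<partial>opt_design k v r) =
    r * (LBINT x:{-1..1}. h x * v x) / 2 + (\<Sum>i<k. p_weight k v r i * h (node k i))"
proof -
  \<comment> \<open>The index \<open>k\<close> carries the continuous part, so the design is one
    weighted sum of k+1 measures.\<close>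
  define \<mu> where "\<mu> i = (if i < k then return leb_I (node k i) else density unif_I (\<lambda>x. ennreal (v x)))" for i
  define c where "c i = (if i < k then p_weight k v r i else r)" for i
  have node: "node k i \<in> space leb_I" for i using node_in_I by simp
  have hm: "h \<in> borel_measurable leb_I" by (rule borel_measurable_leb_I[OF h])
  have "(\<integral>x. h x \<partial>opt_design k v r) = (\<Sum>i\<in>{..<Suc k}. c i * (\<integral>x. h x \<partial>\<mu> i))"
  proof (rule integral_weighted_sum_measure)
    show "emeasure (opt_design k v r) A = (\<Sum>i\<in>{..<Suc k}. ennreal (c i) * emeasure (\<mu> i) A)"
      if "A \<in> sets (opt_design k v r)" for A
      using that by (simp add: emeasure_opt_design \<mu>_def c_def add.commute)
    show "integrable (\<mu> i) h" if "i \<in> {..<Suc k}" for i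
      using integral_density_unif_I(1)[OF v h] prob_space_return[OF node]
      by (auto simp: \<mu>_def intro!: integrable_continuous_I h prob_space.finite_measure)
    show "h \<in> borel_measurable (opt_design k v r)"
      using hm measurable_cong_sets[OF sets_opt_design refl] by blast
  qed (auto simp: \<mu>_def c_def p r)
  also have "\<dots> = (\<Sum>i<k. p_weight k v r i * h (node k i)) + r * (LBINT x:{-1..1}. h x * v x) / 2"
    using integral_density_unif_I(2)[OF v h] integral_return[OF node hm]
    by (simp add: \<mu>_def c_def)
  finally show ?thesis by simp
qed

lemma prob_space_opt_design:
  assumes k: "k \<ge> 2" and v: "weight_fun v" and r: "0 \<le> r"
    and p: "\<And>i. i < k \<Longrightarrow> 0 \<le> p_weight k v r i"
  shows "prob_space (opt_design k v r)"
proof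
  interpret D: prob_space "density unif_I (\<lambda>x. ennreal (v x))"
    by (rule prob_space_density_unif_I[OF v])
  have top: "{-1..1} \<in> sets leb_I" using sets.top[of leb_I] by simp
  have "(\<Sum>i<k. ennreal (p_weight k v r i) * emeasure (return leb_I (node k i)) {-1..1})
    = ennreal (\<Sum>i<k. p_weight k v r i)"
    using node_in_I[of k] p top by (subst sum_ennreal[symmetric]) (auto intro!: sum.cong)
  moreover have "0 \<le> 1 - r" using sum_nonneg[of "{..<k}" "p_weight k v r"] p sum_p_weight[OF k v, of r] by simp
  moreover have "emeasure (density unif_I (\<lambda>x. ennreal (v x))) {-1..1} = 1"
    using D.emeasure_space_1 by simp
  ultimately show "emeasure (opt_design k v r) (space (opt_design k v r)) = 1"
    using r by (simp add: emeasure_opt_design[OF top] sum_p_weight[OF k v] flip: ennreal_plus)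
qed

lemma BV_I_cmult:
  assumes "g \<in> BV_I"
  shows "(\<lambda>x. c * g x) \<in> BV_I"
proof -
  obtain C where C: "\<And>(n::nat) t. t ` {..n} \<subseteq> {-1..1} \<Longrightarrow> mono_on {..n} t \<Longrightarrow>
        (\<Sum>i<n. \<bar>g (t (Suc i)) - g (t i)\<bar>) \<le> C"
    using assms unfolding BV_I_def bounded_variation_on_def by blast
  have "(\<Sum>i<n. \<bar>c * g (t (Suc i)) - c * g (t i)\<bar>) \<le> \<bar>c\<bar> * C"
    if "t ` {..n} \<subseteq> {-1..1}" "mono_on {..n} t" for n :: nat and t
    using mult_left_mono[OF C[OF that], of "\<bar>c\<bar>"]
    by (simp add: sum_distrib_left flip: abs_mult right_diff_distrib)
  then have "bounded_variation_on (\<lambda>x. c * g x) {-1..1}"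
    unfolding bounded_variation_on_def by blast
  then show ?thesis using assms by (auto simp: BV_I_def intro!: continuous_intros)
qed

lemma opt_design_in_designs_above:
  assumes k: "k \<ge> 2" and v: "weight_fun v" and r: "0 \<le> r"
    and p: "\<And>i. i < k \<Longrightarrow> 0 \<le> p_weight k v r i"
  shows "opt_design k v r \<in> designs_above v r"
proof -
  \<comment> \<open>The masses are carried over from indices to points along the inverse of
    \<open>node\<close>.\<close>
  define w where "w t = p_weight k v r (the_inv_into {..<k} (node k) t)" for t
  have w: "w (node k i) = p_weight k v r i" if "i < k" for i
    using that by (simp add: w_def the_inv_into_f_f[OF inj_on_node[OF k]])
  \<comment> \<open>The density with respect to \<open>leb_I\<close>; the factor 1/2 comes from
    \<open>unif_I\<close>.\<close>
  define g where "g x = r / 2 * v x" for x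
  have dens: "scale_measure (ennreal r) (density unif_I (\<lambda>x. ennreal (v x))) = density leb_I (\<lambda>x. ennreal (g x))"
  proof (rule measure_eqI)
    fix A assume "A \<in> sets (scale_measure (ennreal r) (density unif_I (\<lambda>x. ennreal (v x))))"
    then have A: "A \<in> sets leb_I" by simp
    have [measurable]: "v \<in> borel_measurable leb_I" "v \<in> borel_measurable unif_I"
      by (rule weight_fun_measurable[OF v])+
    have "emeasure (density unif_I (\<lambda>x. ennreal (v x))) A = (\<integral>\<^sup>+x. ennreal (v x) * indicator A x \<partial>unif_I)"
      using A by (intro emeasure_density) auto
    also have "\<dots> = ennreal (1/2) * (\<integral>\<^sup>+x. ennreal (v x) * indicator A x \<partial>leb_I)"
      unfolding unif_I_def half_ennreal using A by (intro nn_integral_scale_measure) auto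
    finally have "emeasure (scale_measure (ennreal r) (density unif_I (\<lambda>x. ennreal (v x)))) A
      = ennreal (r / 2) * (\<integral>\<^sup>+x. ennreal (v x) * indicator A x \<partial>leb_I)"
      using r ennreal_mult[of r "1/2"] by (simp only: emeasure_scale_measure mult.assoc[symmetric]) simp
    also have "\<dots> = (\<integral>\<^sup>+x. ennreal (r / 2) * (ennreal (v x) * indicator A x) \<partial>leb_I)"
      using A by (intro nn_integral_cmult[symmetric]) auto
    also have "\<dots> = (\<integral>\<^sup>+x. ennreal (g x) * indicator A x \<partial>leb_I)"
      using r weight_fun_nonneg[OF v]
      by (intro nn_integral_cong) (auto simp: g_def ennreal_mult[symmetric] mult.assoc[symmetric])
    also have "\<dots> = emeasure (density leb_I (\<lambda>x. ennreal (g x))) A"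
      using A by (intro emeasure_density[symmetric]) (auto simp: g_def)
    finally show "emeasure (scale_measure (ennreal r) (density unif_I (\<lambda>x. ennreal (v x)))) A
      = emeasure (density leb_I (\<lambda>x. ennreal (g x))) A" .
  qed simp
  have "opt_design k v r = measure_plus
      (measure_sum leb_I (node k ` {..<k}) (\<lambda>t. scale_measure (ennreal (w t)) (return leb_I t)))
      (density leb_I (\<lambda>x. ennreal (g x)))" (is "_ = ?R")
  proof (rule measure_eqI)
    fix A assume "A \<in> sets (opt_design k v r)"
    then have A: "A \<in> sets leb_I" by simp
    have "emeasure ?R A = (\<Sum>t\<in>node k ` {..<k}. ennreal (w t) * emeasure (return leb_I t) A)
        + emeasure (density leb_I (\<lambda>x. ennreal (g x))) A"
      using A by (subst emeasure_measure_plus) (auto simp: emeasure_measure_sum)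
    also have "(\<Sum>t\<in>node k ` {..<k}. ennreal (w t) * emeasure (return leb_I t) A)
        = (\<Sum>i<k. ennreal (p_weight k v r i) * emeasure (return leb_I (node k i)) A)"
      using inj_on_node[OF k] by (simp add: sum.reindex w)
    finally show "emeasure (opt_design k v r) A = emeasure ?R A"
      using A by (simp add: emeasure_opt_design dens[symmetric] add.commute)
  qed simp
  moreover have "g \<in> BV_I" unfolding g_def using v by (intro BV_I_cmult) (simp add: weight_fun_def)
  moreover have "\<forall>x\<in>{-1..1}. 0 \<le> g x" using weight_fun_nonneg[OF v] r by (simp add: g_def)
  moreover have "\<forall>t\<in>node k ` {..<k}. 0 \<le> w t" using p by (auto simp: w)
  moreover have "finite (node k ` {..<k})" "node k ` {..<k} \<subseteq> {-1..1}" using node_in_I by auto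
  ultimately have "opt_design k v r \<in> designs"
    unfolding designs_def mem_Collect_eq using prob_space_opt_design[OF k v r p] by blast
  then show ?thesis
    by (auto simp: designs_above_def emeasure_opt_design intro!: add_increasing2)
qed

section \<open>Information matrices acting on polynomials\<close>

definition vec_eval :: "real Matrix.vec \<Rightarrow> real \<Rightarrow> real" where
  "vec_eval z x = (\<Sum>i<dim_vec z. vec_index z i * x ^ i)"

lemma continuous_on_vec_eval [continuous_intros]: "continuous_on S (vec_eval z)"
  unfolding vec_eval_def by (intro continuous_intros)

text \<open>Turns equations for M z into moment conditions: M z is a multiple of
  \<open>e_last k\<close> precisely when the polynomial \<open>vec_eval z\<close> is orthogonal to
  all powers below k-1.\<close>

lemma info_mat_mult_vec:
  assumes \<xi>: "finite_measure \<xi>" "sets \<xi> = sets leb_I" and z: "z \<in> carrier_vec k" and i: "i < k"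
  shows "vec_index (info_mat k \<xi> *\<^sub>v z) i = (\<integral>x. x ^ i * vec_eval z x \<partial>\<xi>)"
proof -
  have "vec_index (info_mat k \<xi> *\<^sub>v z) i = (\<Sum>j<k. (\<integral>x. x ^ i * x ^ j \<partial>\<xi>) * vec_index z j)"
    using z i by (auto simp: info_mat_def reg_fun_def scalar_prod_def lessThan_atLeast0 intro!: sum.cong)
  also have "\<dots> = (\<Sum>j<k. \<integral>x. x ^ i * (vec_index z j * x ^ j) \<partial>\<xi>)"
    by (intro sum.cong refl) (simp add: mult_ac flip: integral_mult_right_zero)
  also have "\<dots> = (\<integral>x. (\<Sum>j<k. x ^ i * (vec_index z j * x ^ j)) \<partial>\<xi>)"
    by (intro Bochner_Integration.integral_sum[symmetric] integrable_continuous_I[OF \<xi>] continuous_intros)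
  also have "\<dots> = (\<integral>x. x ^ i * vec_eval z x \<partial>\<xi>)"
    using z by (simp add: vec_eval_def sum_distrib_left)
  finally show ?thesis .
qed

text \<open>The information matrix is the Gram matrix of the monomials in L2 of
  \<open>\<xi>\<close>.\<close>

lemma scalar_prod_info_mat:
  assumes \<xi>: "finite_measure \<xi>" "sets \<xi> = sets leb_I" and w: "w \<in> carrier_vec k" and z: "z \<in> carrier_vec k"
  shows "scalar_prod w (info_mat k \<xi> *\<^sub>v z) = (\<integral>x. vec_eval w x * vec_eval z x \<partial>\<xi>)"
proof -
  have "scalar_prod w (info_mat k \<xi> *\<^sub>v z) = (\<Sum>i<k. vec_index w i * (\<integral>x. x ^ i * vec_eval z x \<partial>\<xi>))"
    using z info_mat_mult_vec[OF \<xi> z] carrier_matD(1)[OF info_mat_carrier[of k \<xi>]]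
    by (auto simp: scalar_prod_def lessThan_atLeast0 intro!: sum.cong)
  also have "\<dots> = (\<Sum>i<k. \<integral>x. vec_index w i * x ^ i * vec_eval z x \<partial>\<xi>)"
    by (simp add: mult.assoc)
  also have "\<dots> = (\<integral>x. (\<Sum>i<k. vec_index w i * x ^ i * vec_eval z x) \<partial>\<xi>)"
    by (intro Bochner_Integration.integral_sum[symmetric] integrable_continuous_I[OF \<xi>] continuous_intros)
  also have "\<dots> = (\<integral>x. vec_eval w x * vec_eval z x \<partial>\<xi>)"
    using w by (simp add: vec_eval_def[of w] sum_distrib_right)
  finally show ?thesis .
qed

section \<open>The Chebyshev polynomial of degree k-1 under \<open>opt_design\<close> and under its
  competitors\<close>

lemma cheb_T_node_square:
  assumes "k \<ge> 2" "i < k"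
  shows "(cheb_T (k - 1) (node k i))\<^sup>2 = 1"
proof -
  have "cheb_T (k - 1) (node k i) = cos (pi * real (k - 1 - i))"
    using assms by (simp add: node_def cheb_T_cos of_nat_diff diff_diff_eq)
  then show ?thesis by (simp add: cos_npi2 flip: power_mult)
qed

lemma obtain_cheb_T_vec:
  obtains t where "t \<in> carrier_vec (Suc n)" "vec_eval t = cheb_T n" "vec_index t n \<noteq> 0"
proof -
  obtain p where p: "degree p = n" "p \<noteq> 0" "\<And>x. poly p x = cheb_T n x"
    using cheb_T_poly by blast
  show ?thesis
  proof (rule that[of "Matrix.vec (Suc n) (coeff p)"])
    show "vec_eval (Matrix.vec (Suc n) (coeff p)) = cheb_T n"
      by (rule ext) (simp add: vec_eval_def poly_altdef lessThan_Suc_atMost p flip: p(3))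
    show "vec_index (Matrix.vec (Suc n) (coeff p)) n \<noteq> 0"
      using p leading_coeff_neq_0[of p] by simp
  qed simp
qed

text \<open>The target is \<open>m = 0\<close>, orthogonality to lower powers; the extra factor
  \<open>cheb_T m\<close> makes the induction on \<open>j\<close> work, since x T_m is the mean of
  T_{m+1} and T_{m-1}. For \<open>j = 0\<close> the product formula leaves two integrals that
  cancel.\<close>

lemma integral_opt_design_power_cheb_T:
  assumes k: "k \<ge> 2" and v: "weight_fun v" and r: "0 \<le> r"
    and p: "\<And>i. i < k \<Longrightarrow> 0 \<le> p_weight k v r i"
    and "j + m < k - 1"
  shows "(\<integral>x. x ^ j * (cheb_T m x * cheb_T (k - 1) x) \<partial>opt_design k v r) = 0"
  using \<open>j + m < k - 1\<close>
proof (induction j arbitrary: m)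
  case 0
  let ?n = "k - 1"
  define C where "C s = (LBINT x:{-1..1}. cheb_T s x * v x)" for s
  interpret prob_space "opt_design k v r" by (rule prob_space_opt_design[OF k v r p])
  have int: "integrable (opt_design k v r) (cheb_T s)" for s
    by (intro integrable_continuous_I continuous_on_cheb_T finite_measure_axioms) simp
  \<comment> \<open>The part of the point masses coming from \<open>nu\<close> contributes nothing,
    and the rest is antisymmetric under the exchange of s and 2(k-1)-s. The indices k-1+m and k-1-m
    are exchanged in this way.\<close>
  have T: "(\<integral>x. cheb_T s x \<partial>opt_design k v r) = r * (C s - C (2 * ?n - s)) / 4"
    if "0 < s" "s < 2 * ?n" for s
  proof -
    have "\<not> 2 * ?n dvd s" using that by (auto dest: dvd_imp_le)
    then have "(\<Sum>i<k. p_weight k v r i * cheb_T s (node k i)) = - r * (C s + C (2 * ?n - s)) / 4"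
      using sum_nu_cheb_T_node[OF k, of s] sum_q_weight_cheb_T_node[OF k that(2), of v] that
      by (simp add: p_weight_def C_def left_diff_distrib sum_subtractf mult.assoc
          flip: sum_divide_distrib sum_distrib_left)
    moreover have "(\<integral>x. cheb_T s x \<partial>opt_design k v r) =
        r * C s / 2 + (\<Sum>i<k. p_weight k v r i * cheb_T s (node k i))"
      unfolding C_def by (rule integral_opt_design[OF v r p continuous_on_cheb_T])
    ultimately show ?thesis by (simp only:) (simp add: algebra_simps diff_divide_distrib add_divide_distrib)
  qed
  have prod: "cheb_T m x * cheb_T ?n x = (cheb_T (?n + m) x + cheb_T (?n - m) x) / 2" for x
    unfolding mult.commute[of "cheb_T m x"] by (rule cheb_T_mult) (use 0 in simp)
  have "(\<integral>x. x ^ 0 * (cheb_T m x * cheb_T ?n x) \<partial>opt_design k v r)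
    = (\<integral>x. (cheb_T (?n + m) x + cheb_T (?n - m) x) / 2 \<partial>opt_design k v r)"
    by (simp only: prod power_0 mult_1_left)
  also have "\<dots> = ((\<integral>x. cheb_T (?n + m) x \<partial>opt_design k v r) + (\<integral>x. cheb_T (?n - m) x \<partial>opt_design k v r)) / 2"
    using int by simp
  also have "\<dots> = 0"
  proof -
    have d: "2 * ?n - (?n + m) = ?n - m" "2 * ?n - (?n - m) = ?n + m"
      and s: "0 < ?n + m" "?n + m < 2 * ?n" "0 < ?n - m" "?n - m < 2 * ?n"
      using 0 by auto
    show ?thesis
      unfolding T[OF s(1,2)] T[OF s(3,4)] d by (simp add: right_diff_distrib diff_divide_distrib)
  qed
  finally show ?case .
next
  case (Suc j)
  interpret prob_space "opt_design k v r" by (rule prob_space_opt_design[OF k v r p])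
  have int: "integrable (opt_design k v r) (\<lambda>x. x ^ j * (cheb_T s x * cheb_T (k - 1) x))" for s
    by (intro integrable_continuous_I continuous_intros continuous_on_cheb_T finite_measure_axioms) simp
  show ?case
  \<comment> \<open>For \<open>m = 0\<close> there is no T_{m-1}; there x T_0 is simply T_1.\<close>
  proof (cases m)
    case 0
    then show ?thesis using Suc.IH[of 1] Suc.prems by (simp add: mult_ac)
  next
    case (Suc l)
    have step: "x ^ Suc j * (cheb_T m x * cheb_T (k - 1) x) =
      (x ^ j * (cheb_T (Suc m) x * cheb_T (k - 1) x) + x ^ j * (cheb_T l x * cheb_T (k - 1) x)) / 2" for x
    proof -
      have "x ^ Suc j * (cheb_T m x * cheb_T (k - 1) x) = x ^ j * ((x * cheb_T m x) * cheb_T (k - 1) x)"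
        by (simp add: mult_ac)
      also have "x * cheb_T m x = (cheb_T (Suc m) x + cheb_T l x) / 2" by (simp add: Suc)
      finally show ?thesis by (simp add: distrib_left distrib_right add_divide_distrib)
    qed
    have "(\<integral>x. x ^ j * (cheb_T (Suc m) x * cheb_T (k - 1) x) \<partial>opt_design k v r) = 0"
      by (rule Suc.IH) (use Suc.prems \<open>m = Suc l\<close> in simp)
    moreover have "(\<integral>x. x ^ j * (cheb_T l x * cheb_T (k - 1) x) \<partial>opt_design k v r) = 0"
      by (rule Suc.IH) (use Suc.prems \<open>m = Suc l\<close> in simp)
    ultimately show ?thesis
      unfolding step using int[of "Suc m"] int[of l] by (simp del: cheb_T.simps)
  qed
qed

text \<open>The square equals 1 at every node, so the discrete part contributes its whole mass 1 -
  r.\<close>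

lemma integral_cheb_T_square_opt_design:
  assumes k: "k \<ge> 2" and v: "weight_fun v" and r: "0 \<le> r"
    and p: "\<And>i. i < k \<Longrightarrow> 0 \<le> p_weight k v r i"
  shows "(\<integral>x. (cheb_T (k - 1) x)\<^sup>2 \<partial>opt_design k v r) =
    r * (LBINT x:{-1..1}. (cheb_T (k - 1) x)\<^sup>2 * v x) / 2 + (1 - r)"
  using cheb_T_node_square[OF k] sum_p_weight[OF k v]
  by (subst integral_opt_design[OF v r p]) (auto intro!: continuous_intros continuous_on_cheb_T)

text \<open>If the integral were 0, \<open>v\<close> would vanish almost everywhere, as
  \<open>cheb_T n\<close> has finitely many zeros; but \<open>v\<close> has Lebesgue integral
  2.\<close>

lemma integral_cheb_T_square_weight_pos:
  assumes v: "weight_fun v"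
  shows "0 < (LBINT x:{-1..1}. (cheb_T n x)\<^sup>2 * v x)"
proof -
  obtain p where p: "p \<noteq> 0" "\<And>x. poly p x = cheb_T n x" using cheb_T_poly by blast
  have int: "integrable leb_I (\<lambda>x. (cheb_T n x)\<^sup>2 * v x)"
    by (intro integrable_leb_I_times weight_fun_integrable[OF v] continuous_intros continuous_on_cheb_T)
  have nn: "AE x in leb_I. 0 \<le> (cheb_T n x)\<^sup>2 * v x"
    by (rule AE_I2) (simp add: weight_fun_nonneg[OF v])
  have "(\<integral>x. (cheb_T n x)\<^sup>2 * v x \<partial>leb_I) \<noteq> 0"
  proof
    assume "(\<integral>x. (cheb_T n x)\<^sup>2 * v x \<partial>leb_I) = 0"
    then have "AE x in leb_I. (cheb_T n x)\<^sup>2 * v x = 0"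
      using integral_nonneg_eq_0_iff_AE[OF int nn] by simp
    moreover have "AE x in leb_I. cheb_T n x \<noteq> 0"
    proof -
      have "{x. poly p x = 0} \<in> null_sets lborel"
        by (intro finite_imp_null_set_lborel poly_roots_finite p)
      then have "AE x in lborel. cheb_T n x \<noteq> 0"
        by (rule AE_I') (auto simp: p)
      then show ?thesis unfolding leb_I_def by (subst AE_restrict_space_iff) auto
    qed
    ultimately have "AE x in leb_I. v x = 0" by eventually_elim simp
    then have "(\<integral>x. v x \<partial>leb_I) = 0" by (rule integral_eq_zero_AE)
    then show False using integral_leb_I_weight_fun[OF v] by simp
  qed
  moreover have "0 \<le> (\<integral>x. (cheb_T n x)\<^sup>2 * v x \<partial>leb_I)" by (rule integral_nonneg_AE[OF nn])
  ultimately show ?thesis by (simp add: integral_leb_I)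
qed

text \<open>Domination is applied to 1 - T_n^2, which is nonnegative on [-1,1]; since
  \<open>\<eta>\<close> has mass 1, this becomes an upper bound for the integral of T_n^2. For
  \<open>n = k - 1\<close> the bound is the value under \<open>opt_design\<close>.\<close>

lemma integral_cheb_T_square_le:
  assumes v: "weight_fun v" and r: "0 \<le> r" and \<eta>: "\<eta> \<in> designs_above v r"
  shows "(\<integral>x. (cheb_T n x)\<^sup>2 \<partial>\<eta>) \<le> r * (LBINT x:{-1..1}. (cheb_T n x)\<^sup>2 * v x) / 2 + (1 - r)"
proof -
  let ?D = "density unif_I (\<lambda>x. ennreal (v x))"
  let ?h = "\<lambda>x. 1 - (cheb_T n x)\<^sup>2"
  have sets: "sets \<eta> = sets leb_I" using \<eta> by (auto simp: designs_above_def designs_def)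
  have sp: "space \<eta> = {-1..1}" using sets_eq_imp_space_eq[OF sets] by simp
  interpret prob_space \<eta> using \<eta> by (simp add: designs_above_def designs_def)
  have h: "continuous_on {-1..1} ?h" and T: "continuous_on {-1..1} (\<lambda>x. (cheb_T n x)\<^sup>2)"
    by (intro continuous_intros continuous_on_cheb_T)+
  have h0: "0 \<le> ?h x" if "x \<in> {-1..1}" for x
    using cheb_T_abs_le_1[OF that, of n] by (simp add: abs_square_le_1)
  have inth: "integrable \<eta> ?h" and intT: "integrable \<eta> (\<lambda>x. (cheb_T n x)\<^sup>2)"
    by (intro integrable_continuous_I finite_measure_axioms sets h T)+
  note intD = integral_density_unif_I[OF v]
  interpret D: prob_space ?D by (rule prob_space_density_unif_I[OF v])
  have "scale_measure (ennreal r) ?D \<le> \<eta>"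
    using \<eta> sets by (subst le_measure) (auto simp: designs_above_def)
  then have "(\<integral>\<^sup>+x. ennreal (?h x) \<partial>scale_measure (ennreal r) ?D) \<le> (\<integral>\<^sup>+x. ennreal (?h x) \<partial>\<eta>)"
    using sets by (intro nn_integral_mono_measure) auto
  moreover have "(\<integral>\<^sup>+x. ennreal (?h x) \<partial>scale_measure (ennreal r) ?D)
      = ennreal (\<integral>x. ?h x \<partial>scale_measure (ennreal r) ?D)"
    by (intro nn_integral_eq_integral integral_scale_measure r intD h AE_I2 h0) (simp add: space_scale_measure)
  moreover have "(\<integral>\<^sup>+x. ennreal (?h x) \<partial>\<eta>) = ennreal (\<integral>x. ?h x \<partial>\<eta>)"
    by (intro nn_integral_eq_integral inth AE_I2 h0) (simp add: sp)
  moreover have "0 \<le> (\<integral>x. ?h x \<partial>\<eta>)"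
    by (intro integral_nonneg_AE AE_I2 h0) (simp add: sp)
  ultimately have "(\<integral>x. ?h x \<partial>scale_measure (ennreal r) ?D) \<le> (\<integral>x. ?h x \<partial>\<eta>)"
    by (simp add: ennreal_le_iff)
  also have "(\<integral>x. ?h x \<partial>\<eta>) = 1 - (\<integral>x. (cheb_T n x)\<^sup>2 \<partial>\<eta>)"
    using intT by (simp add: prob_space)
  finally show ?thesis
    using intD[OF T] D.prob_space
    by (simp add: integral_scale_measure[OF r intD(1)[OF h]] algebra_simps)
qed

text \<open>Orthogonality gives M t = l e_k, and t^T M t = \<open>\<rho>\<close> identifies l. Hence
  t / l solves M z = e_k, whether or not M is singular, and its last coordinate is the
  criterion.\<close>

lemma c_criterion_opt_design:
  assumes k: "k \<ge> 2" and v: "weight_fun v" and r: "0 \<le> r"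
    and p: "\<And>i. i < k \<Longrightarrow> 0 \<le> p_weight k v r i"
    and t: "t \<in> carrier_vec k" "vec_eval t = cheb_T (k - 1)" "vec_index t (k - 1) \<noteq> 0"
    and \<rho>: "(\<integral>x. (cheb_T (k - 1) x)\<^sup>2 \<partial>opt_design k v r) = \<rho>" "\<rho> \<noteq> 0"
  shows "c_criterion k (e_last k) (opt_design k v r) = ereal ((vec_index t (k - 1))\<^sup>2 / \<rho>)"
proof -
  let ?M = "info_mat k (opt_design k v r)"
  interpret prob_space "opt_design k v r" by (rule prob_space_opt_design[OF k v r p])
  note fm = finite_measure_axioms sets_opt_design
  define l where "l = vec_index (?M *\<^sub>v t) (k - 1)"
  have Mt: "?M *\<^sub>v t = l \<cdot>\<^sub>v e_last k"
  proof (rule eq_vecI)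
    fix i assume "i < dim_vec (l \<cdot>\<^sub>v e_last k)"
    then have i: "i < k" by simp
    show "vec_index (?M *\<^sub>v t) i = vec_index (l \<cdot>\<^sub>v e_last k) i"
    proof (cases "i = k - 1")
      case False
      then have "(\<integral>x. x ^ i * (cheb_T 0 x * cheb_T (k - 1) x) \<partial>opt_design k v r) = 0"
        using i by (intro integral_opt_design_power_cheb_T[OF k v r p]) auto
      then show ?thesis using info_mat_mult_vec[OF fm t(1) i] t(2) i False by simp
    qed (use i in \<open>simp add: l_def\<close>)
  qed (use carrier_matD(1)[OF info_mat_carrier[of k "opt_design k v r"]] in simp)
  have "scalar_prod t (?M *\<^sub>v t) = \<rho>"
    using scalar_prod_info_mat[OF fm t(1) t(1)] \<rho>(1) t(2) by (simp add: power2_eq_square)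
  then have tl: "l * vec_index t (k - 1) = \<rho>"
    using t(1) k by (simp add: Mt)
  then have l: "l \<noteq> 0" using \<rho>(2) by auto
  have "?M *\<^sub>v ((1 / l) \<cdot>\<^sub>v t) = e_last k"
    using mult_mat_vec[OF info_mat_carrier t(1), of "opt_design k v r" "1 / l"] Mt l
    by (simp add: smult_smult_assoc)
  then have "c_criterion k (e_last k) (opt_design k v r) = ereal (scalar_prod (e_last k) ((1 / l) \<cdot>\<^sub>v t))"
    using t(1) by (intro c_criterion_eq) auto
  also have "scalar_prod (e_last k) ((1 / l) \<cdot>\<^sub>v t) = (vec_index t (k - 1))\<^sup>2 / \<rho>"
    using t(1,3) k l by (simp add: tl[symmetric] power2_eq_square)
  finally show ?thesis .
qed

text \<open>For a solution \<open>z\<close> of M z = e_k, the criterion is the squared L2 norm of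
  \<open>vec_eval z\<close>, and its inner product with \<open>vec_eval t\<close> is the last
  coordinate of \<open>t\<close>; Cauchy-Schwarz does the rest. With a positive upper bound
  \<open>\<rho>\<close> in place of the integral itself, no zero integral has to be treated
  separately.\<close>

lemma c_criterion_ge:
  assumes k: "k \<ge> 2" and \<eta>: "finite_measure \<eta>" "sets \<eta> = sets leb_I"
    and t: "t \<in> carrier_vec k" and \<rho>: "(\<integral>x. (vec_eval t x)\<^sup>2 \<partial>\<eta>) \<le> \<rho>" "0 < \<rho>"
  shows "ereal ((vec_index t (k - 1))\<^sup>2 / \<rho>) \<le> c_criterion k (e_last k) \<eta>"
proof (cases "\<exists>z. z \<in> carrier_vec k \<and> info_mat k \<eta> *\<^sub>v z = e_last k")
  case True
  then obtain z where z: "z \<in> carrier_vec k" "info_mat k \<eta> *\<^sub>v z = e_last k" by blast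
  \<comment> \<open>This \<open>s\<close> minimizes the quadratic in \<open>s\<close> that bounds
    the squared norm of \<open>vec_eval z - s * vec_eval t\<close> below.\<close>
  define s where "s = vec_index t (k - 1) / \<rho>"
  have int_zz: "integrable \<eta> (\<lambda>x. vec_eval z x * vec_eval z x)"
    and int_tz: "integrable \<eta> (\<lambda>x. vec_eval t x * vec_eval z x)"
    and int_tt: "integrable \<eta> (\<lambda>x. (vec_eval t x)\<^sup>2)"
    by (intro integrable_continuous_I[OF \<eta>] continuous_intros)+
  have zz: "(\<integral>x. vec_eval z x * vec_eval z x \<partial>\<eta>) = vec_index z (k - 1)"
    using scalar_prod_info_mat[OF \<eta> z(1) z(1)] z k by simp
  have tz: "(\<integral>x. vec_eval t x * vec_eval z x \<partial>\<eta>) = vec_index t (k - 1)"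
    using scalar_prod_info_mat[OF \<eta> t z(1)] z t k by simp
  have "0 \<le> (\<integral>x. (vec_eval z x - s * vec_eval t x)\<^sup>2 \<partial>\<eta>)" by simp
  also have "\<dots> = (\<integral>x. vec_eval z x * vec_eval z x - 2 * s * (vec_eval t x * vec_eval z x)
      + s\<^sup>2 * (vec_eval t x)\<^sup>2 \<partial>\<eta>)"
    by (intro Bochner_Integration.integral_cong refl) (simp add: power2_eq_square algebra_simps)
  also have "\<dots> = vec_index z (k - 1) - 2 * s * vec_index t (k - 1) + s\<^sup>2 * (\<integral>x. (vec_eval t x)\<^sup>2 \<partial>\<eta>)"
    using int_zz int_tz int_tt by (simp add: zz tz)
  also have "\<dots> \<le> vec_index z (k - 1) - 2 * s * vec_index t (k - 1) + s\<^sup>2 * \<rho>"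
    using \<rho>(1) by (simp add: mult_left_mono)
  also have "\<dots> = vec_index z (k - 1) - (vec_index t (k - 1))\<^sup>2 / \<rho>"
    using \<rho>(2) by (simp add: s_def power2_eq_square)
  finally show ?thesis
    using c_criterion_eq[OF z] z(1) k by simp
next
  case False
  then show ?thesis using c_criterion_infinite[of "e_last k" k \<eta>] by simp
qed

text \<open>The first conjunct guarantees that no point mass in \<open>opt_design\<close> is
  truncated at 0.\<close>

theorem theorem3p2:
  fixes k :: nat and v :: "real \<Rightarrow> real" and r :: real
  assumes "k \<ge> 2"
    and "weight_fun v"
    and "r \<in> {0..alpha0 k v}"
  shows "(\<forall>i<k. p_weight k v r i \<ge> 0) \<and>
         c_optimal k (e_last k) (designs_above v r) (opt_design k v r)"
proof -
  note k = assms(1) and v = assms(2)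
  have r: "0 \<le> r" using assms(3) by simp
  have p: "\<And>i. i < k \<Longrightarrow> 0 \<le> p_weight k v r i" by (rule p_weight_nonneg[OF k assms(3)])
  have "Suc (k - 1) = k" using k by simp
  with obtain_cheb_T_vec[of "k - 1"] obtain t
    where t: "t \<in> carrier_vec k" "vec_eval t = cheb_T (k - 1)" "vec_index t (k - 1) \<noteq> 0"
    by metis
  define \<rho> where "\<rho> = r * (LBINT x:{-1..1}. (cheb_T (k - 1) x)\<^sup>2 * v x) / 2 + (1 - r)"
  have "0 \<le> 1 - r" using sum_nonneg[of "{..<k}" "p_weight k v r"] p sum_p_weight[OF k v, of r] by simp
  then have r1: "r \<le> 1" by simp
  \<comment> \<open>For \<open>r = 0\<close> the value is 1. For \<open>r > 0\<close> the integral
    term is positive, which also covers \<open>r = 1\<close>, where the discrete part has no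
    mass.\<close>
  have \<rho>: "0 < \<rho>"
  proof (cases "r = 0")
    case False
    then have "0 < r * (LBINT x:{-1..1}. (cheb_T (k - 1) x)\<^sup>2 * v x) / 2"
      using r integral_cheb_T_square_weight_pos[OF v] by simp
    then show ?thesis using r1 unfolding \<rho>_def by linarith
  qed (simp add: \<rho>_def)
  have "c_criterion k (e_last k) (opt_design k v r) \<le> c_criterion k (e_last k) \<eta>"
    if \<eta>: "\<eta> \<in> designs_above v r" for \<eta>
  proof -
    have "prob_space \<eta>" and sets: "sets \<eta> = sets leb_I"
      using \<eta> by (auto simp: designs_above_def designs_def)
    then have "finite_measure \<eta>" by (simp add: prob_space.finite_measure)
    moreover have "(\<integral>x. (vec_eval t x)\<^sup>2 \<partial>\<eta>) \<le> \<rho>"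
      unfolding t(2) \<rho>_def by (rule integral_cheb_T_square_le[OF v r \<eta>])
    ultimately have "ereal ((vec_index t (k - 1))\<^sup>2 / \<rho>) \<le> c_criterion k (e_last k) \<eta>"
      using \<rho> by (intro c_criterion_ge[OF k _ sets t(1)])
    moreover have "(\<integral>x. (cheb_T (k - 1) x)\<^sup>2 \<partial>opt_design k v r) = \<rho>"
      unfolding \<rho>_def by (rule integral_cheb_T_square_opt_design[OF k v r p])
    then have "c_criterion k (e_last k) (opt_design k v r) = ereal ((vec_index t (k - 1))\<^sup>2 / \<rho>)"
      using \<rho> by (intro c_criterion_opt_design[OF k v r p t]) auto
    ultimately show ?thesis by simp
  qed
  then show ?thesis
    using p opt_design_in_designs_above[OF k v r p] by (auto simp: c_optimal_def)
qed

end
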